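(* Let $d\ge2$, $h>4d+1$, $0<\beta\le1$, let $V_{\mathrm{hi}}:\mathbb{Z}^d\to\{0,h\}$ be a hierarchical potential, and let $H(\omega)=2d-\Delta+V_{\mathrm{hi}}+\beta V_{\mathrm r}(\omega)$ on $\mathbb{Z}^d$. Put $\iota=\min\{\tfrac1{100},\tfrac{h-4d-\beta}{2}\}$ and $\mathcal{P}_k=\{n\in\mathbb{Z}^d:n_d=k\}$. There exist $\varepsilon=\varepsilon(d)>0$ and $C_1=C_1(h,\beta,d)\gg1$ such that the following holds for every $\lambda\in[-\iota,4d+\beta+\iota]$ and every initial datum $u_0$ on $\mathcal{P}_0\cup\mathcal{P}_1$. Let $u$ be the solution on $\mathbb{Z}^d$ of $$H(\omega)u-\lambda u=0,\qquad u\equiv u_0\ \text{ on }\ \mathcal{P}_0\cup\mathcal{P}_1.$$ For $L\ge C_1$, let $\mathcal{E}_{\mathrm{uc}}(L,u_0,\lambda)$ be the event that there exists a subset $T\subset Q_L(0)=\{x\in\mathbb{Z}^d:|x|\le L\}$ with $\#T\ge\varepsilon L^d$ such that $$|u(n)|\ge \exp\{-C_1L\}\,|u(0)|\qquad\text{for all }n\in T.$$ Then $$\mathbb{P}\bigl(\mathcal{E}_{\mathrm{uc}}(L,u_0,\lambda)\bigr)\ge1-\exp\{-\varepsilon L\},$$ where $\mathbb{P}$ only concerns the random variables in $Q_L(0)$.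
   Context: $|\cdot|$ and $|\cdot|_1$ are the $\ell^\infty$- and $\ell^1$-norms on $\mathbb{Z}^d$; $\mathrm{dist}$ and $\mathrm{diam}$ on $\mathbb{Z}^d$ are with respect to $|\cdot|$. $\Delta f(x)=\sum_{y:\,|y-x|_1=1}f(y)$. $\#$ is cardinality. The initial datum $u_0$ and $\lambda$ are fixed (non-random). Randomness: $V_{\mathrm r}(\omega)=\{V_{\mathrm r,x}(\omega)\}_{x\in\mathbb{Z}^d}$ are i.i.d. on $\Omega=\{0,1\}^{\mathbb{Z}^d}$ with $\mathbb{P}(V_{\mathrm r,x}=0)=\mathbb{P}(V_{\mathrm r,x}=1)=\tfrac12$, acting as a multiplication operator. Hierarchical potential (with parameters $d_0>1$, $\alpha>1$, integer $N\ge1$): let $d_{k+1}=d_k^{\alpha}$, $\Lambda_k(j)=\{x\in\mathbb{Z}^d:|x-j|\le 2\lfloor 3d_k\rfloor\}$, $\Lambda_k=\Lambda_k(0)$. For $V:\mathbb{Z}^d\to\{0,h\}$ let $\mathcal{W}=\{x:V(x)=0\}$. $V$ is $(1,N)$-hierarchical in $\Lambda_1(j)$ if $\mathcal{W}\cap\Lambda_1(j)=\bigcup_{1\le s\le N_1}C_0^s$ with $N_1\le N$, $\mathrm{diam}(C_0^s)\le 4\lfloor 3d_0\rfloor$ for all $s$, $C_0^1\subset\Lambda_0(j)$, and $\mathrm{dist}(C_0^s,C_0^{s'})\ge 2d_1$ for $s\ne s'$. For $k\ge2$, $V$ is $(k,N)$-hierarchical in $\Lambda_k(j)$ if $\mathcal{W}\cap\Lambda_k(j)=\bigcup_{1\le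 s\le N_k}C_{k-1}^s$ with $N_k\le N$, $C_{k-1}^1\subset\Lambda_{k-1}(j)$, $\mathrm{dist}(C_{k-1}^s,C_{k-1}^{s'})\ge 2d_k$ for $s\neq s'$, $V$ is $(k-1,N)$-hierarchical in $\Lambda_{k-1}(j)$, and for each $2\le s\le N_k$ there is $\Lambda_{k-1}(j_s)\subset\Lambda_k(j)$ with $C_{k-1}^s\subset\Lambda_{k-1}(j_s)$ and $V$ is $(k-1,N)$-hierarchical in $\Lambda_{k-1}(j_s)$. $V$ is a hierarchical potential if it is $(k,N)$-hierarchical in $\Lambda_k$ for all $k\ge1$. *)

theory Defs
  imports "HOL-Probability.Probability"
begin

text \<open>
  The lattice \<open>\<int>\<^sup>d\<close> is the type \<^typ>\<open>int ^ 'd\<close> over a finite index type \<open>'d\<close>, so that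
  \<open>d = CARD('d)\<close>.
\<close>

definition linf :: "int ^ 'd \<Rightarrow> int" where
  "linf x = Max (range (\<lambda>i. \<bar>x $ i\<bar>))"

definition l1 :: "int ^ 'd \<Rightarrow> int" where
  "l1 x = (\<Sum>i\<in>UNIV. \<bar>x $ i\<bar>)"

definition cube :: "real \<Rightarrow> (int ^ 'd) set" where
  "cube L = {x. real_of_int (linf x) \<le> L}"

text \<open>
  Distance and diameter take values in \<^typ>\<open>ennreal\<close>, so that the distance to the empty set is
  infinite and the diameter of the empty set is zero.
\<close>

definition lat_dist :: "(int ^ 'd) set \<Rightarrow> (int ^ 'd) set \<Rightarrow> ennreal" where
  "lat_dist A B = (INF x\<in>A. INF y\<in>B. ennreal (real_of_int (linf (x - y))))"

definition lat_diam :: "(int ^ 'd) set \<Rightarrow> ennreal" where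
  "lat_diam A = (SUP x\<in>A. SUP y\<in>A. ennreal (real_of_int (linf (x - y))))"

primrec dscale :: "real \<Rightarrow> real \<Rightarrow> nat \<Rightarrow> real" where
  "dscale d0 \<alpha> 0 = d0"
| "dscale d0 \<alpha> (Suc k) = dscale d0 \<alpha> k powr \<alpha>"

definition block :: "real \<Rightarrow> real \<Rightarrow> nat \<Rightarrow> int ^ 'd \<Rightarrow> (int ^ 'd) set" where
  "block d0 \<alpha> k j = {x. linf (x - j) \<le> 2 * \<lfloor>3 * dscale d0 \<alpha> k\<rfloor>}"

definition wells :: "(int ^ 'd \<Rightarrow> real) \<Rightarrow> (int ^ 'd) set" where
  "wells V = {x. V x = 0}"

text \<open>
  \<open>hierarchical_in d0 \<alpha> N V k j\<close>: the potential \<open>V\<close> is \<open>(k, N)\<close>-hierarchical in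
  \<open>\<Lambda>\<^sub>k(j)\<close>, for \<open>k \<ge> 1\<close>; the value at \<open>k = 0\<close> is irrelevant. The number \<open>m\<close> of clusters is
  at least one because a first cluster is singled out; clusters may be empty.
\<close>

fun hierarchical_in ::
    "real \<Rightarrow> real \<Rightarrow> nat \<Rightarrow> (int ^ 'd \<Rightarrow> real) \<Rightarrow> nat \<Rightarrow> int ^ 'd \<Rightarrow> bool" where
  "hierarchical_in d0 \<alpha> N V 0 j \<longleftrightarrow> False"
| "hierarchical_in d0 \<alpha> N V (Suc 0) j \<longleftrightarrow>
    (\<exists>m C. 1 \<le> m \<and> m \<le> N \<and>
      wells V \<inter> block d0 \<alpha> 1 j = (\<Union>s\<in>{1..m}. C s) \<and>
      (\<forall>s\<in>{1..m}. lat_diam (C s) \<le> ennreal (real_of_int (4 * \<lfloor>3 * dscale d0 \<alpha> 0\<rfloor>))) \<and>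
      C 1 \<subseteq> block d0 \<alpha> 0 j \<and>
      (\<forall>s\<in>{1..m}. \<forall>t\<in>{1..m}. s \<noteq> t \<longrightarrow>
        lat_dist (C s) (C t) \<ge> ennreal (2 * dscale d0 \<alpha> 1)))"
| "hierarchical_in d0 \<alpha> N V (Suc (Suc k)) j \<longleftrightarrow>
    (\<exists>m C. 1 \<le> m \<and> m \<le> N \<and>
      wells V \<inter> block d0 \<alpha> (Suc (Suc k)) j = (\<Union>s\<in>{1..m}. C s) \<and>
      C 1 \<subseteq> block d0 \<alpha> (Suc k) j \<and>
      (\<forall>s\<in>{1..m}. \<forall>t\<in>{1..m}. s \<noteq> t \<longrightarrow>
        lat_dist (C s) (C t) \<ge> ennreal (2 * dscale d0 \<alpha> (Suc (Suc k)))) \<and>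
      hierarchical_in d0 \<alpha> N V (Suc k) j \<and>
      (\<forall>s\<in>{2..m}. \<exists>js.
        block d0 \<alpha> (Suc k) js \<subseteq> block d0 \<alpha> (Suc (Suc k)) j \<and>
        C s \<subseteq> block d0 \<alpha> (Suc k) js \<and>
        hierarchical_in d0 \<alpha> N V (Suc k) js))"

definition hierarchical_potential ::
    "real \<Rightarrow> real \<Rightarrow> nat \<Rightarrow> real \<Rightarrow> (int ^ 'd \<Rightarrow> real) \<Rightarrow> bool" where
  "hierarchical_potential d0 \<alpha> N h V \<longleftrightarrow>
    range V \<subseteq> {0, h} \<and> (\<forall>k\<ge>1. hierarchical_in d0 \<alpha> N V k 0)"

text \<open>
  Configurations in \<open>{0,1}\<close> to the power \<open>\<int>\<^sup>d\<close> are Boolean functions; the random potential at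
  \<open>x\<close> is \<open>of_bool (\<omega> x)\<close>.
\<close>

definition coin_measure :: "(int ^ 'd \<Rightarrow> bool) measure" where
  "coin_measure = (\<Pi>\<^sub>M x\<in>UNIV. measure_pmf (bernoulli_pmf (1/2)))"

definition laplacian :: "(int ^ 'd \<Rightarrow> complex) \<Rightarrow> int ^ 'd \<Rightarrow> complex" where
  "laplacian f x = (\<Sum>y\<in>{y. l1 (y - x) = 1}. f y)"

definition hamiltonian ::
    "(int ^ 'd \<Rightarrow> real) \<Rightarrow> real \<Rightarrow> (int ^ 'd \<Rightarrow> bool) \<Rightarrow> (int ^ 'd \<Rightarrow> complex) \<Rightarrow> int ^ 'd \<Rightarrow> complex"
  where
  "hamiltonian V \<beta> \<omega> f x =
    2 * of_nat CARD('d) * f x - laplacian f x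
      + of_real (V x) * f x + of_real (\<beta> * of_bool (\<omega> x)) * f x"

text \<open>
  The index \<open>e\<close> is the coordinate written \<open>n\<^sub>d\<close> in the usual numbering.
\<close>

definition hyperplane :: "'d \<Rightarrow> int \<Rightarrow> (int ^ 'd) set" where
  "hyperplane e k = {n. n $ e = k}"

definition is_solution ::
    "(int ^ 'd \<Rightarrow> real) \<Rightarrow> real \<Rightarrow> 'd \<Rightarrow> real \<Rightarrow> (int ^ 'd \<Rightarrow> complex) \<Rightarrow> (int ^ 'd \<Rightarrow> bool)
      \<Rightarrow> (int ^ 'd \<Rightarrow> complex) \<Rightarrow> bool" where
  "is_solution V \<beta> e lam u0 \<omega> u \<longleftrightarrow>
    (\<forall>x. hamiltonian V \<beta> \<omega> u x - of_real lam * u x = 0) \<and>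
    (\<forall>x \<in> hyperplane e 0 \<union> hyperplane e 1. u x = u0 x)"

definition solution ::
    "(int ^ 'd \<Rightarrow> real) \<Rightarrow> real \<Rightarrow> 'd \<Rightarrow> real \<Rightarrow> (int ^ 'd \<Rightarrow> complex) \<Rightarrow> (int ^ 'd \<Rightarrow> bool)
      \<Rightarrow> int ^ 'd \<Rightarrow> complex" where
  "solution V \<beta> e lam u0 \<omega> = (THE u. is_solution V \<beta> e lam u0 \<omega> u)"

text \<open>
  The equation determines the solution from its values on two adjacent hyperplanes: it gives
  \<open>u\<close> on each further hyperplane in terms of the two preceding ones.
\<close>

definition lateral :: "'d \<Rightarrow> int ^ 'd \<Rightarrow> (int ^ 'd) set" where
  "lateral e x = {y. l1 (y - x) = 1 \<and> y $ e = x $ e}"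

lemma finite_l1_sphere: "finite {y :: int ^ 'd. l1 (y - x) = 1}"
proof -
  have "{y :: int ^ 'd. l1 (y - x) = 1} \<subseteq>
      (\<lambda>f. \<chi> i. f i) ` (\<Pi>\<^sub>E i\<in>UNIV. {x $ i - 1..x $ i + 1})"
  proof
    fix y :: "int ^ 'd" assume y: "y \<in> {y. l1 (y - x) = 1}"
    have "\<bar>(y - x) $ i\<bar> \<le> 1" for i
    proof -
      have "\<bar>(y - x) $ i\<bar> \<le> (\<Sum>j\<in>UNIV. \<bar>(y - x) $ j\<bar>)"
        by (rule member_le_sum) auto
      with y show ?thesis by (simp add: l1_def)
    qed
    then have "(\<lambda>i. y $ i) \<in> (\<Pi>\<^sub>E i\<in>UNIV. {x $ i - 1..x $ i + 1})"
      by (auto simp: abs_le_iff algebra_simps)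
    moreover have "y = (\<chi> i. y $ i)" by simp
    ultimately show "y \<in> (\<lambda>f. \<chi> i. f i) ` (\<Pi>\<^sub>E i\<in>UNIV. {x $ i - 1..x $ i + 1})"
      by blast
  qed
  then show ?thesis
    by (rule finite_subset) (auto intro!: finite_imageI finite_PiE)
qed

lemma l1_axis: "l1 (axis e a :: int ^ 'd) = \<bar>a\<bar>"
proof -
  have "l1 (axis e a :: int ^ 'd) = (\<Sum>i\<in>UNIV. if i = e then \<bar>a\<bar> else 0)"
    unfolding l1_def by (rule sum.cong) (auto simp: axis_def)
  then show ?thesis by simp
qed

lemma l1_eq_1_cases:
  fixes z :: "int ^ 'd"
  assumes "l1 z = 1" "z $ e \<noteq> 0"
  shows "z = axis e 1 \<or> z = axis e (- 1)"
proof -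
  have "(\<Sum>i\<in>UNIV. \<bar>z $ i\<bar>) = \<bar>z $ e\<bar> + (\<Sum>i\<in>UNIV - {e}. \<bar>z $ i\<bar>)"
    by (rule sum.remove) auto
  moreover have "(\<Sum>i\<in>UNIV - {e}. \<bar>z $ i\<bar>) \<ge> 0" by (rule sum_nonneg) auto
  ultimately have *: "\<bar>z $ e\<bar> = 1" "(\<Sum>i\<in>UNIV - {e}. \<bar>z $ i\<bar>) = 0"
    using assms unfolding l1_def by linarith+
  then have "\<forall>i\<in>UNIV - {e}. \<bar>z $ i\<bar> = 0"
    by (subst (asm) sum_nonneg_eq_0_iff) auto
  then show ?thesis using *(1) by (auto simp: vec_eq_iff axis_def abs_if split: if_splits)
qed

lemma laplacian_split:
  fixes f :: "int ^ 'd \<Rightarrow> complex" and e :: 'd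
  shows
  "laplacian f x = f (x + axis e 1) + f (x - axis e 1) + (\<Sum>y\<in>lateral e x. f y)"
proof -
  have m: "axis e (- 1) = - (axis e 1 :: int ^ 'd)" by (simp add: vec_eq_iff axis_def)
  have eq: "{y. l1 (y - x) = 1} = {x + axis e 1, x - axis e 1} \<union> lateral e x"
  proof (intro equalityI subsetI)
    fix y assume "y \<in> {y. l1 (y - x) = 1}"
    then have y: "l1 (y - x) = 1" by simp
    show "y \<in> {x + axis e 1, x - axis e 1} \<union> lateral e x"
    proof (cases "y $ e = x $ e")
      case True then show ?thesis using y by (simp add: lateral_def)
    next
      case False
      then have "y - x = axis e 1 \<or> y - x = - axis e 1"
        using l1_eq_1_cases[OF y, of e] m by simp
      then show ?thesis by (auto simp: algebra_simps)
    qed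
  next
    fix y assume "y \<in> {x + axis e 1, x - axis e 1} \<union> lateral e x"
    then show "y \<in> {y. l1 (y - x) = 1}"
      using l1_axis[of e 1] l1_axis[of e "- 1"] by (auto simp: lateral_def m)
  qed
  have fin: "finite (lateral e x)"
    by (rule finite_subset[OF _ finite_l1_sphere[of x]]) (auto simp: lateral_def)
  have "x + axis e 1 \<noteq> x - axis e 1" by (auto simp: vec_eq_iff axis_def dest!: spec[of _ e])
  moreover have "{x + axis e 1, x - axis e 1} \<inter> lateral e x = {}"
    by (auto simp: lateral_def axis_def)
  ultimately show ?thesis
    unfolding laplacian_def eq using fin by (subst sum.union_disjoint) auto
qed

function propagate ::
    "'d::finite \<Rightarrow> (int ^ 'd \<Rightarrow> complex) \<Rightarrow> (int ^ 'd \<Rightarrow> complex) \<Rightarrow> int ^ 'd \<Rightarrow> complex" where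
  "propagate e g u0 x =
    (if x $ e = 0 \<or> x $ e = 1 then u0 x
     else let s = axis e (if x $ e > 1 then 1 else - 1) in
       g (x - s) * propagate e g u0 (x - s) - propagate e g u0 (x - s - s)
         - (\<Sum>y\<in>lateral e (x - s). propagate e g u0 y))"
  by pat_completeness auto
termination
  by (relation "Wellfounded.measure (\<lambda>(e, g, u0, x). nat \<bar>2 * (x $ e) - 1\<bar>)")
    (auto simp: lateral_def axis_def)

declare propagate.simps [simp del]

lemma is_solution_iff_recurrence:
  fixes u :: "int ^ 'd \<Rightarrow> complex" and e :: 'd
  defines "s \<equiv> (axis e 1 :: int ^ 'd)"
  shows "is_solution V \<beta> e lam u0 \<omega> u \<longleftrightarrow>
    (\<forall>x. u (x + s) + u (x - s) + (\<Sum>y\<in>lateral e x. u y) =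
      (2 * of_nat CARD('d) + of_real (V x) + of_real (\<beta> * of_bool (\<omega> x)) - of_real lam) * u x) \<and>
    (\<forall>x. x $ e = 0 \<or> x $ e = 1 \<longrightarrow> u x = u0 x)"
  unfolding is_solution_def hamiltonian_def laplacian_split[of _ _ e] s_def hyperplane_def
  by (intro arg_cong2[where f = "(\<and>)"] all_cong1) (auto simp: algebra_simps add_eq_0_iff)

lemma ex1_solution:
  fixes V :: "int ^ 'd \<Rightarrow> real"
  shows "\<exists>!u. is_solution V \<beta> e lam u0 \<omega> u"
proof -
  define g :: "int ^ 'd \<Rightarrow> complex" where "g x = 2 * of_nat CARD('d) + of_real (V x)
      + of_real (\<beta> * of_bool (\<omega> x)) - of_real lam" for x
  define s :: "int ^ 'd" where "s = axis e 1"
  have se: "s $ e = 1" by (simp add: s_def axis_def)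
  have m: "axis e (- 1) = - s" by (simp add: vec_eq_iff axis_def s_def)
  define p where "p = propagate e g u0"
  have p0: "p x = u0 x" if "x $ e = 0 \<or> x $ e = 1" for x
    unfolding p_def using that by (subst propagate.simps) simp
  have p1: "p x = g (x - s) * p (x - s) - p (x - s - s) - (\<Sum>y\<in>lateral e (x - s). p y)"
    if "x $ e > 1" for x
    unfolding p_def using that by (subst propagate.simps) (simp add: s_def Let_def)
  have p2: "p x = g (x + s) * p (x + s) - p (x + s + s) - (\<Sum>y\<in>lateral e (x + s). p y)"
    if "x $ e < 0" for x
    unfolding p_def using that by (subst propagate.simps) (simp add: m Let_def add.commute)
  have iff: "is_solution V \<beta> e lam u0 \<omega> u \<longleftrightarrow>
    (\<forall>x. u (x + s) + u (x - s) + (\<Sum>y\<in>lateral e x. u y) = g x * u x) \<and>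
    (\<forall>x. x $ e = 0 \<or> x $ e = 1 \<longrightarrow> u x = u0 x)" for u
    unfolding is_solution_iff_recurrence s_def g_def ..
  show ?thesis
  proof (rule ex1I[of _ p])
    show "is_solution V \<beta> e lam u0 \<omega> p"
      unfolding iff
    proof (intro conjI allI impI)
      fix x
      show "p (x + s) + p (x - s) + (\<Sum>y\<in>lateral e x. p y) = g x * p x"
      proof (cases "x $ e > 0")
        case True then show ?thesis using p1[of "x + s"] se by simp
      next
        case False then show ?thesis using p2[of "x - s"] se by simp
      qed
    qed (use p0 in auto)
  next
    fix u assume u: "is_solution V \<beta> e lam u0 \<omega> u"
    then have eq: "u (x + s) + u (x - s) + (\<Sum>y\<in>lateral e x. u y) = g x * u x" for x
      unfolding iff by blast
    have "u x = p x" for x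
    proof (induction "nat \<bar>2 * (x $ e) - 1\<bar>" arbitrary: x rule: less_induct)
      case less
      consider "x $ e = 0 \<or> x $ e = 1" | "x $ e > 1" | "x $ e < 0" by linarith
      then show ?case
      proof cases
        case 1 then show ?thesis using u p0 unfolding iff by auto
      next
        case 2
        have "u (x - s) = p (x - s)" "u (x - s - s) = p (x - s - s)"
          using 2 se by (auto intro!: less)
        moreover have "(\<Sum>y\<in>lateral e (x - s). u y) = (\<Sum>y\<in>lateral e (x - s). p y)"
          using 2 se by (intro sum.cong refl less) (auto simp: lateral_def)
        ultimately show ?thesis using eq[of "x - s"] p1[OF 2]
          by (simp add: algebra_simps) (metis add_right_cancel)
      next
        case 3
        have "u (x + s) = p (x + s)" "u (x + s + s) = p (x + s + s)"
          using 3 se by (auto intro!: less)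
        moreover have "(\<Sum>y\<in>lateral e (x + s). u y) = (\<Sum>y\<in>lateral e (x + s). p y)"
          using 3 se by (intro sum.cong refl less) (auto simp: lateral_def)
        ultimately show ?thesis using eq[of "x + s"] p2[OF 3]
          by (simp add: algebra_simps) (metis add_right_cancel)
      qed
    qed
    then show "u = p" by blast
  qed
qed

definition uc_event ::
    "(int ^ 'd \<Rightarrow> real) \<Rightarrow> real \<Rightarrow> 'd \<Rightarrow> real \<Rightarrow> real \<Rightarrow> real \<Rightarrow> (int ^ 'd \<Rightarrow> complex) \<Rightarrow> real
      \<Rightarrow> (int ^ 'd \<Rightarrow> bool) set" where
  "uc_event V \<beta> e \<epsilon> C1 L u0 lam =
    {\<omega>. \<exists>T \<subseteq> cube L. real (card T) \<ge> \<epsilon> * L ^ CARD('d) \<and>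
      (\<forall>n\<in>T. norm (solution V \<beta> e lam u0 \<omega> n)
              \<ge> exp (- C1 * L) * norm (solution V \<beta> e lam u0 \<omega> 0))}"

end

theory Submission imports Defs begin

text \<open>
  Write \<open>lat\<close> for the \<open>\<ell>\<^sup>1\<close>-norm of the coordinates other than \<open>e\<close>. Fix a column
  \<open>{p + k s}\<close> in direction \<open>s = axis e 1\<close> and foliate the half space above \<open>p\<close> by the light cones
  \<open>\<Sigma>\<^sub>m = {x. x $ e + lat (x - p) = m}\<close>. The equation propagates smallness on two consecutive cones
  down to all earlier ones, so at least one of \<open>\<Sigma>\<^sub>m\<close>, \<open>\<Sigma>\<^sub>m\<^sub>+\<^sub>1\<close> carries a point \<open>c\<close>
  where \<open>u\<close> is not exponentially smaller than \<open>u 0\<close>. The values of \<open>u\<close> on \<open>\<Sigma>\<^sub>m\<close> do not depend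
  on the coins on \<open>\<Sigma>\<^sub>m\<close>, while flipping the coin at \<open>c\<close> moves \<open>u\<close> at the column point of
  \<open>\<Sigma>\<^sub>m\<^sub>+\<^sub>1\<close> by \<open>\<plusminus> M \<beta> u c\<close>, where \<open>M \<ge> 1\<close> is the number of lattice geodesics from \<open>c\<close> to the
  column. Hence along each column a fair coin is tossed on at least every second cone, and a Chernoff
  bound gives a positive fraction of large values outside an event of probability \<open>exp (- c L)\<close>;
  a union bound over the \<open>O(L\<^sup>d\<^sup>-\<^sup>1)\<close> columns finishes the proof.
\<close>

section \<open>Reduction of the coin measure to counting finitely many configurations\<close>

lemma finite_configs:
  assumes "finite J"
  shows "finite {\<omega> :: 'a \<Rightarrow> bool. \<forall>x. x \<notin> J \<longrightarrow> \<omega> x = \<eta> x}"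
proof (rule inj_on_finite)
  show "inj_on (\<lambda>\<omega>. {x \<in> J. \<omega> x}) {\<omega>. \<forall>x. x \<notin> J \<longrightarrow> \<omega> x = \<eta> x}"
  proof (rule inj_onI, rule ext)
    fix \<omega> \<omega>' x
    assume "\<omega> \<in> {\<omega>. \<forall>x. x \<notin> J \<longrightarrow> \<omega> x = \<eta> x}" "\<omega>' \<in> {\<omega>. \<forall>x. x \<notin> J \<longrightarrow> \<omega> x = \<eta> x}"
      "{x \<in> J. \<omega> x} = {x \<in> J. \<omega>' x}"
    then show "\<omega> x = \<omega>' x" by (cases "x \<in> J") auto
  qed
  show "finite (Pow J)" using assms by simp
qed auto

lemma coin_measure_cylinder:
  fixes J :: "(int ^ 'd) set"
  assumes "finite J"
  shows "{\<omega>. \<forall>x\<in>J. \<omega> x = b x} \<in> sets coin_measure"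
    and "measure coin_measure {\<omega>. \<forall>x\<in>J. \<omega> x = b x} = (1/2) ^ card J"
proof -
  let ?M = "\<lambda>_ :: int ^ 'd. measure_pmf (bernoulli_pmf (1/2))"
  interpret product_prob_space ?M UNIV
    by (intro product_prob_spaceI measure_pmf.prob_space_axioms)
  have eq: "{\<omega>. \<forall>x\<in>J. \<omega> x = b x} = prod_emb UNIV ?M J (PiE J (\<lambda>x. {b x}))"
    by (auto simp: prod_emb_def restrict_def PiE_iff extensional_def space_PiM)
  show "{\<omega>. \<forall>x\<in>J. \<omega> x = b x} \<in> sets coin_measure"
    unfolding eq coin_measure_def using assms by (intro sets_PiM_I) auto
  have half: "measure (measure_pmf (bernoulli_pmf (1/2))) {c} = 1/2" for c
    by (cases c) (simp_all add: measure_pmf_single)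
  show "measure coin_measure {\<omega>. \<forall>x\<in>J. \<omega> x = b x} = (1/2) ^ card J"
    unfolding eq coin_measure_def using assms by (subst measure_PiM_emb) (simp_all add: half del: measure_pmf_single)
qed

lemma prob_space_coin_measure: "prob_space coin_measure"
  unfolding coin_measure_def by (intro prob_space_PiM measure_pmf.prob_space_axioms)

text \<open>Resampling the coins in \<open>J\<close> and freezing all others at
  \<open>\<eta>\<close> has the uniform law on \<open>\<Omega>\<close>: each element of
  \<open>\<Omega>\<close> is attained on one cylinder over \<open>J\<close>, and all these cylinders
  have the same probability. Probabilities thereby become proportions of a finite set.\<close>

lemma measure_coin_override:
  fixes J :: "(int ^ 'd) set" and \<eta> :: "int ^ 'd \<Rightarrow> bool"
  defines "\<Omega> \<equiv> {\<omega>. \<forall>x. x \<notin> J \<longrightarrow> \<omega> x = \<eta> x}"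
  assumes J: "finite J"
  shows "measure coin_measure {\<omega>. override_on \<eta> \<omega> J \<in> S} * real (card \<Omega>) = real (card (\<Omega> \<inter> S))"
proof -
  interpret prob_space "coin_measure :: (int ^ 'd \<Rightarrow> bool) measure" by (rule prob_space_coin_measure)
  have fin: "finite \<Omega>" unfolding \<Omega>_def using J by (rule finite_configs)
  have *: "measure coin_measure {\<omega>. override_on \<eta> \<omega> J \<in> S} = real (card (\<Omega> \<inter> S)) * (1/2) ^ card J"
    for S
  proof -
    have "{\<omega>. override_on \<eta> \<omega> J \<in> S} = (\<Union>\<omega>'\<in>\<Omega> \<inter> S. {\<omega>. \<forall>x\<in>J. \<omega> x = \<omega>' x})" (is "?l = ?r")
    proof (intro equalityI subsetI)
      fix \<omega> assume "\<omega> \<in> ?l"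
      then show "\<omega> \<in> ?r" by (auto simp: \<Omega>_def override_on_def intro!: bexI[of _ "override_on \<eta> \<omega> J"])
    next
      fix \<omega> assume "\<omega> \<in> ?r"
      then obtain \<omega>' where w: "\<omega>' \<in> \<Omega> \<inter> S" "\<forall>x\<in>J. \<omega> x = \<omega>' x" by blast
      then have "override_on \<eta> \<omega> J = \<omega>'" by (auto simp: \<Omega>_def override_on_def fun_eq_iff)
      then show "\<omega> \<in> ?l" using w by simp
    qed
    moreover have "measure coin_measure (\<Union>\<omega>'\<in>\<Omega> \<inter> S. {\<omega>. \<forall>x\<in>J. \<omega> x = \<omega>' x}) =
        (\<Sum>\<omega>'\<in>\<Omega> \<inter> S. measure coin_measure {\<omega>. \<forall>x\<in>J. \<omega> x = \<omega>' x})"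
    proof (rule finite_measure_finite_Union)
      show "disjoint_family_on (\<lambda>\<omega>'. {\<omega>. \<forall>x\<in>J. \<omega> x = \<omega>' x}) (\<Omega> \<inter> S)"
        unfolding disjoint_family_on_def
      proof (intro ballI impI)
        fix \<omega> \<omega>' assume "\<omega> \<in> \<Omega> \<inter> S" "\<omega>' \<in> \<Omega> \<inter> S" "\<omega> \<noteq> \<omega>'"
        then obtain x where "\<omega> x \<noteq> \<omega>' x" "x \<in> J" by (auto simp: \<Omega>_def fun_eq_iff)
        then show "{\<omega>''. \<forall>x\<in>J. \<omega>'' x = \<omega> x} \<inter> {\<omega>''. \<forall>x\<in>J. \<omega>'' x = \<omega>' x} = {}" by auto
      qed
    qed (use fin coin_measure_cylinder(1)[OF J] in auto)
    ultimately show ?thesis by (simp add: coin_measure_cylinder(2)[OF J])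
  qed
  have sp: "space coin_measure = (UNIV :: (int ^ 'd \<Rightarrow> bool) set)"
    by (simp add: coin_measure_def space_PiM)
  \<comment> \<open>The case \<open>S = UNIV\<close> has total mass one and so identifies the common
    cylinder probability as \<open>1 / card \<Omega>\<close>.\<close>
  have "1 = real (card \<Omega>) * (1/2) ^ card J" using *[of UNIV] prob_space sp by simp
  then show ?thesis using *[of S] by (simp add: mult.assoc mult.commute)
qed

section \<open>Numerical estimates\<close>

text \<open>Closes the union bound: \<open>(2r+1)^k\<close> columns, each bad with probability at
  most \<open>4^(-(k+1)r)\<close>. Since \<open>2r+1 \<le> 3^r\<close>, the product is at most
  \<open>(3/4)^((k+1)r)\<close>, and \<open>3/4 \<le> exp (-1/4)\<close>.\<close>

lemma power_tail_bound: "(2 * real r + 1) ^ k * (1/4) ^ (Suc k * r) \<le> exp (- (real (Suc k) * real r / 4))"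
proof -
  have "(2 * real r + 1) ^ k \<le> (2 * real r + 1) ^ Suc k" by (intro power_increasing) auto
  also have "\<dots> \<le> (3 ^ r) ^ Suc k"
    using Bernoulli_inequality[of "2 :: real" r] by (intro power_mono) (auto simp: mult.commute)
  finally have "(2 * real r + 1) ^ k * (1/4) ^ (Suc k * r) \<le> (3 ^ r) ^ Suc k * (1/4) ^ (Suc k * r)"
    by (intro mult_right_mono) auto
  also have "\<dots> = 3 ^ (Suc k * r) * (1/4) ^ (Suc k * r)"
    by (simp only: power_mult[symmetric] mult.commute[of r])
  also have "\<dots> = (3/4) ^ (Suc k * r)" by (simp only: power_mult_distrib[symmetric]) simp
  also have "\<dots> \<le> exp (- 1/4) ^ (Suc k * r)"
    using exp_ge_add_one_self[of "- 1/4"] by (intro power_mono) auto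
  also have "\<dots> = exp (- (real (Suc k) * real r / 4))"
    by (simp only: exp_of_nat_mult[symmetric] of_nat_mult) simp
  finally show ?thesis .
qed

text \<open>The part \<open>ln K\<close> of \<open>C\<close> pays for the growth \<open>K^n\<close>
  with \<open>n \<le> L\<close>; the part \<open>2/\<beta>\<close> leaves a factor
  \<open>exp (-2/\<beta>) \<le> \<beta>/2\<close>.\<close>

lemma exp_power_bound:
  fixes K L C :: real
  assumes "\<beta> > 0" "K \<ge> 1" "L \<ge> 1" "C \<ge> ln K + 2 / \<beta>" "real n \<le> L"
  shows "2 * exp (- C * L) * K ^ n \<le> \<beta>"
proof -
  have "ln K * real n \<le> ln K * L" using assms by (intro mult_left_mono) auto
  moreover have "2 / \<beta> * 1 \<le> 2 / \<beta> * L" using assms by (intro mult_left_mono) auto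
  moreover have "(ln K + 2 / \<beta>) * L \<le> C * L" using assms by (intro mult_right_mono) auto
  ultimately have "- C * L + real n * ln K \<le> - (2 / \<beta>)" by (simp add: algebra_simps)
  then have "exp (- C * L + real n * ln K) \<le> exp (- (2 / \<beta>))" by simp
  moreover have "exp (real n * ln K) = K ^ n" using assms by (simp only: exp_of_nat_mult) simp
  ultimately have "exp (- C * L) * K ^ n \<le> exp (- (2 / \<beta>))" by (simp only: exp_add)
  also have "\<dots> \<le> \<beta> / 2"
  proof -
    have "2 / \<beta> \<le> exp (2 / \<beta>)" using exp_ge_add_one_self[of "2 / \<beta>"] by linarith
    then have "inverse (exp (2 / \<beta>)) \<le> inverse (2 / \<beta>)" using assms by (intro le_imp_inverse_le) auto
    then show ?thesis by (simp add: exp_minus)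
  qed
  finally show ?thesis by simp
qed

section \<open>The lateral norm and its change between lateral neighbours\<close>

definition lat :: "'d::finite \<Rightarrow> int ^ 'd \<Rightarrow> int" where
  "lat e x = (\<Sum>i\<in>UNIV - {e}. \<bar>x $ i\<bar>)"

lemma lat_nonneg: "lat e x \<ge> 0"
  unfolding lat_def by (rule sum_nonneg) auto

lemma lat_add_axis: "lat e (x + axis e a) = lat e x"
  unfolding lat_def by (rule sum.cong) (auto simp: axis_def)

lemma lat_diff_axis: "lat e (x - axis e a) = lat e x"
  unfolding lat_def by (rule sum.cong) (auto simp: axis_def)

lemma lat_triangle: "lat e (x - z) \<le> lat e (x - y) + lat e (y - z)"
  unfolding lat_def sum.distrib[symmetric] by (rule sum_mono) auto

lemma lat_commute: "lat e (x - y) = lat e (y - x)"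
  unfolding lat_def by (rule sum.cong) auto

lemma component_le_lat: "i \<noteq> e \<Longrightarrow> \<bar>x $ i\<bar> \<le> lat e x"
  unfolding lat_def by (rule member_le_sum) auto

lemma lat_step:
  assumes "i \<noteq> e"
  shows "lat e (w + axis i a) = lat e w - \<bar>w $ i\<bar> + \<bar>w $ i + a\<bar>"
proof -
  have "lat e v = \<bar>v $ i\<bar> + (\<Sum>j\<in>UNIV - {e} - {i}. \<bar>v $ j\<bar>)" for v :: "int ^ 'a"
    unfolding lat_def using assms by (intro sum.remove) auto
  moreover have "(\<Sum>j\<in>UNIV - {e} - {i}. \<bar>(w + axis i a) $ j\<bar>) =
      (\<Sum>j\<in>UNIV - {e} - {i}. \<bar>w $ j\<bar>)"
    by (rule sum.cong) (auto simp: axis_def)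
  ultimately show ?thesis by (simp add: axis_def)
qed

lemma lateral_iff:
  "y \<in> lateral e x \<longleftrightarrow> (\<exists>i a. i \<noteq> e \<and> (a = 1 \<or> a = - 1) \<and> y = x + axis i a)"
proof
  assume y: "y \<in> lateral e x"
  then have l: "l1 (y - x) = 1" and ye: "y $ e = x $ e" by (auto simp: lateral_def)
  then obtain i where i: "(y - x) $ i \<noteq> 0" by (force simp: l1_def)
  then have "y - x = axis i 1 \<or> y - x = axis i (- 1)" using l1_eq_1_cases[OF l] by blast
  then have "y = x + axis i 1 \<or> y = x + axis i (- 1)" by (auto simp: algebra_simps)
  moreover have "i \<noteq> e" using i ye by auto
  ultimately show "\<exists>i a. i \<noteq> e \<and> (a = 1 \<or> a = - 1) \<and> y = x + axis i a" by blast
next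
  assume "\<exists>i a. i \<noteq> e \<and> (a = 1 \<or> a = - 1) \<and> y = x + axis i a"
  then obtain i a where "i \<noteq> e" "a = 1 \<or> a = - 1" "y = x + axis i a" by blast
  then show "y \<in> lateral e x"
    using l1_axis[of i a] by (auto simp: lateral_def axis_def)
qed

lemma lat_lateral:
  assumes "y \<in> lateral e x"
  shows "lat e (y - z) = lat e (x - z) + 1 \<or> lat e (y - z) = lat e (x - z) - 1"
proof -
  obtain i a where i: "i \<noteq> e" "a = 1 \<or> a = - 1" "y = x + axis i a"
    using assms lateral_iff by blast
  then have "lat e (y - z) = lat e (x - z) - \<bar>(x - z) $ i\<bar> + \<bar>(x - z) $ i + a\<bar>"
    using lat_step[of i e "x - z" a] by (simp add: algebra_simps)
  then show ?thesis using i(2) by (auto simp: abs_if)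
qed

text \<open>One unit step towards \<open>z\<close> in any coordinate other than \<open>e\<close> in
  which \<open>x\<close> and \<open>z\<close> differ. This provides the geodesic that keeps the
  factor \<open>M\<close> at least 1 in \<open>flip_cone_boundary\<close>.\<close>

lemma lateral_closer:
  assumes "lat e (x - z) > 0"
  obtains y where "y \<in> lateral e x" "lat e (y - z) = lat e (x - z) - 1"
proof -
  obtain i where i: "i \<noteq> e" "(x - z) $ i \<noteq> 0"
  proof -
    have "(\<Sum>i\<in>UNIV - {e}. \<bar>(x - z) $ i\<bar>) \<noteq> 0" using assms unfolding lat_def by simp
    then obtain i where "i \<in> UNIV - {e}" "\<bar>(x - z) $ i\<bar> \<noteq> 0"
      by (rule sum.not_neutral_contains_not_neutral)
    then show ?thesis using that[of i] by auto
  qed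
  define a where "a = (if (x - z) $ i > 0 then - 1 else 1 :: int)"
  have "x + axis i a \<in> lateral e x" using i by (auto simp: lateral_iff a_def)
  moreover have "lat e (x + axis i a - z) = lat e (x - z) - 1"
    using lat_step[of i e "x - z" a] i by (auto simp: algebra_simps a_def)
  ultimately show ?thesis by (rule that)
qed

lemma finite_lateral: "finite (lateral e x)"
  by (rule finite_subset[OF _ finite_l1_sphere[of x]]) (auto simp: lateral_def)

lemma card_lateral: "card (lateral e x) = card (lateral e 0)"
proof -
  have "lateral e x = (\<lambda>y. x + y) ` lateral e 0"
    by (auto simp: lateral_iff intro!: imageI) blast+
  then show ?thesis by (simp add: card_image)
qed

section \<open>A Chernoff bound by pairing configurations\<close>

text \<open>
  \<open>X m\<close> announces a coin toss at time \<open>m\<close>, \<open>\<phi> m\<close> flips that coin, \<open>A m\<close> is its success. The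
  weights make the product a supermartingale: \<open>4/3 \<cdot> (1 + 1/2) / 2 = 1\<close>.
\<close>

lemma sum_involution_weight_le_card:
  fixes X A :: "nat \<Rightarrow> 'a \<Rightarrow> bool" and \<phi> :: "nat \<Rightarrow> 'a \<Rightarrow> 'a"
  defines "f \<equiv> \<lambda>m \<omega>. (if X m \<omega> then 4/3 else 1) * (if X m \<omega> \<and> A m \<omega> then 1/2 else 1 :: real)"
  assumes "finite \<Omega>"
    and closed: "\<And>m \<omega>. m < n \<Longrightarrow> \<omega> \<in> \<Omega> \<Longrightarrow> \<phi> m \<omega> \<in> \<Omega>"
    and invol: "\<And>m \<omega>. m < n \<Longrightarrow> \<omega> \<in> \<Omega> \<Longrightarrow> \<phi> m (\<phi> m \<omega>) = \<omega>"
    and inv_X: "\<And>m i \<omega>. m < n \<Longrightarrow> i \<le> m \<Longrightarrow> \<omega> \<in> \<Omega> \<Longrightarrow> X i (\<phi> m \<omega>) = X i \<omega>"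
    and inv_A: "\<And>m i \<omega>. m < n \<Longrightarrow> i < m \<Longrightarrow> \<omega> \<in> \<Omega> \<Longrightarrow> A i (\<phi> m \<omega>) = A i \<omega>"
    and alt: "\<And>m \<omega>. m < n \<Longrightarrow> \<omega> \<in> \<Omega> \<Longrightarrow> X m \<omega> \<Longrightarrow> A m \<omega> \<or> A m (\<phi> m \<omega>)"
    and "k \<le> n"
  shows "(\<Sum>\<omega>\<in>\<Omega>. \<Prod>m<k. f m \<omega>) \<le> real (card \<Omega>)"
  using \<open>k \<le> n\<close>
proof (induction k)
  case (Suc k)
  then have k: "k < n" by simp
  define W where "W \<omega> = (\<Prod>m<k. f m \<omega>)" for \<omega>
  have W0: "W \<omega> \<ge> 0" for \<omega> unfolding W_def f_def by (intro prod_nonneg) auto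
  have W_inv: "W (\<phi> k \<omega>) = W \<omega>" if "\<omega> \<in> \<Omega>" for \<omega>
    unfolding W_def f_def using inv_X[OF k _ that] inv_A[OF k _ that]
    by (intro prod.cong) auto
  have bij: "bij_betw (\<phi> k) \<Omega> \<Omega>"
    by (rule bij_betwI[of _ _ _ "\<phi> k"]) (auto simp: closed[OF k] invol[OF k])
  \<comment> \<open>The involution pairs each configuration with the one where the coin of round
    \<open>k\<close> is flipped. The factor \<open>W\<close> collects the earlier rounds only, so it
    takes the same value on both.\<close>
  have "(\<Sum>\<omega>\<in>\<Omega>. W \<omega> * f k \<omega>) = (\<Sum>\<omega>\<in>\<Omega>. W (\<phi> k \<omega>) * f k (\<phi> k \<omega>))"
    using sum.reindex_bij_betw[OF bij, of "\<lambda>\<omega>. W \<omega> * f k \<omega>"] by simp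
  also have "\<dots> = (\<Sum>\<omega>\<in>\<Omega>. W \<omega> * f k (\<phi> k \<omega>))"
    by (rule sum.cong) (simp_all add: W_inv)
  finally have "2 * (\<Sum>\<omega>\<in>\<Omega>. W \<omega> * f k \<omega>) = (\<Sum>\<omega>\<in>\<Omega>. W \<omega> * (f k \<omega> + f k (\<phi> k \<omega>)))"
    by (simp add: sum.distrib distrib_left)
  also have "\<dots> \<le> (\<Sum>\<omega>\<in>\<Omega>. W \<omega> * 2)"
  proof (intro sum_mono mult_left_mono W0)
    fix \<omega> assume w: "\<omega> \<in> \<Omega>"
    \<comment> \<open>With a toss, at least one of the two configurations succeeds, so the sum is at
      most \<open>4/3 * (1/2 + 1) = 2\<close>; without a toss both weights are 1.\<close>
    show "f k \<omega> + f k (\<phi> k \<omega>) \<le> 2"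
      using alt[OF k w] inv_X[OF k le_refl w] by (auto simp: f_def)
  qed
  also have "\<dots> = 2 * (\<Sum>\<omega>\<in>\<Omega>. W \<omega>)" by (simp add: sum_distrib_right[symmetric])
  finally have "(\<Sum>\<omega>\<in>\<Omega>. W \<omega> * f k \<omega>) \<le> (\<Sum>\<omega>\<in>\<Omega>. W \<omega>)" by simp
  also have "\<dots> \<le> real (card \<Omega>)" using Suc unfolding W_def by simp
  finally show ?case by (simp add: W_def)
qed simp

text \<open>Each of the \<open>k\<close> disjoint pairs \<open>{2j, 2j+1}\<close> contributes an
  index.\<close>

lemma card_consecutive:
  fixes P :: "nat \<Rightarrow> bool"
  assumes "\<And>i. P i \<or> P (Suc i)"
  shows "k \<le> card {i. i < 2 * k \<and> P i}"
proof (induction k)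
  case (Suc k)
  obtain j where j: "j = 2 * k \<or> j = Suc (2 * k)" "P j" using assms[of "2 * k"] by blast
  have "Suc k \<le> card (insert j {i. i < 2 * k \<and> P i})" using j Suc by (subst card_insert_disjoint) auto
  also have "\<dots> \<le> card {i. i < 2 * Suc k \<and> P i}" using j by (intro card_mono) auto
  finally show ?case .
qed simp

text \<open>Markov's inequality for the weight of \<open>sum_involution_weight_le_card\<close>: at
  least \<open>k\<close> of the \<open>2 * k\<close> rounds have a toss, which gives a factor at
  least \<open>(4/3)^k\<close>, and at most \<open>z\<close> successes cost no more than
  \<open>2^z\<close>. So the weight is at least \<open>(4/3)^k * (1/2)^z\<close> on every
  configuration counted, while its mean is at most 1.\<close>

lemma card_few_successes:
  fixes X A :: "nat \<Rightarrow> 'a \<Rightarrow> bool" and \<phi> :: "nat \<Rightarrow> 'a \<Rightarrow> 'a"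
  assumes fin: "finite \<Omega>"
    and "\<And>m \<omega>. m < 2 * k \<Longrightarrow> \<omega> \<in> \<Omega> \<Longrightarrow> \<phi> m \<omega> \<in> \<Omega>"
    and "\<And>m \<omega>. m < 2 * k \<Longrightarrow> \<omega> \<in> \<Omega> \<Longrightarrow> \<phi> m (\<phi> m \<omega>) = \<omega>"
    and "\<And>m i \<omega>. m < 2 * k \<Longrightarrow> i \<le> m \<Longrightarrow> \<omega> \<in> \<Omega> \<Longrightarrow> X i (\<phi> m \<omega>) = X i \<omega>"
    and "\<And>m i \<omega>. m < 2 * k \<Longrightarrow> i < m \<Longrightarrow> \<omega> \<in> \<Omega> \<Longrightarrow> A i (\<phi> m \<omega>) = A i \<omega>"
    and "\<And>m \<omega>. m < 2 * k \<Longrightarrow> \<omega> \<in> \<Omega> \<Longrightarrow> X m \<omega> \<Longrightarrow> A m \<omega> \<or> A m (\<phi> m \<omega>)"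
    and X: "\<And>m \<omega>. \<omega> \<in> \<Omega> \<Longrightarrow> X m \<omega> \<or> X (Suc m) \<omega>"
  shows "real (card {\<omega>\<in>\<Omega>. card {m. m < 2 * k \<and> A m \<omega>} \<le> z}) * (4/3) ^ k \<le> 2 ^ z * real (card \<Omega>)"
proof -
  let ?f = "\<lambda>m \<omega>. (if X m \<omega> then 4/3 else 1) * (if X m \<omega> \<and> A m \<omega> then 1/2 else 1 :: real)"
  let ?B = "{\<omega>\<in>\<Omega>. card {m. m < 2 * k \<and> A m \<omega>} \<le> z}"
  have f0: "(\<Prod>m<2*k. ?f m \<omega>) \<ge> 0" for \<omega> by (intro prod_nonneg) auto
  have low: "(4/3) ^ k * (1/2) ^ z \<le> (\<Prod>m<2*k. ?f m \<omega>)" if w: "\<omega> \<in> ?B" for \<omega>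
  proof -
    have "(4/3 :: real) ^ k \<le> (4/3) ^ card {m. m < 2 * k \<and> X m \<omega>}"
      using w X by (intro power_increasing card_consecutive) auto
    moreover have "(1/2 :: real) ^ z \<le> (1/2) ^ card {m. m < 2 * k \<and> X m \<omega> \<and> A m \<omega>}"
    proof (rule power_decreasing)
      have "card {m. m < 2 * k \<and> X m \<omega> \<and> A m \<omega>} \<le> card {m. m < 2 * k \<and> A m \<omega>}"
        by (intro card_mono) auto
      then show "card {m. m < 2 * k \<and> X m \<omega> \<and> A m \<omega>} \<le> z" using w by simp
    qed auto
    moreover have "(\<Prod>m<2*k. ?f m \<omega>) =
        (4/3) ^ card {m. m < 2 * k \<and> X m \<omega>} * (1/2) ^ card {m. m < 2 * k \<and> X m \<omega> \<and> A m \<omega>}"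
      by (simp only: prod.distrib) (simp add: prod.If_cases Int_def lessThan_def)
    ultimately show ?thesis by (simp only:) (rule mult_mono; simp)
  qed
  have "real (card ?B) * ((4/3) ^ k * (1/2) ^ z) = (\<Sum>\<omega>\<in>?B. (4/3) ^ k * (1/2) ^ z)" by simp
  also have "\<dots> \<le> (\<Sum>\<omega>\<in>?B. \<Prod>m<2*k. ?f m \<omega>)" by (intro sum_mono low)
  also have "\<dots> \<le> (\<Sum>\<omega>\<in>\<Omega>. \<Prod>m<2*k. ?f m \<omega>)" using fin f0 by (intro sum_mono2) auto
  also have "\<dots> \<le> real (card \<Omega>)"
    by (rule sum_involution_weight_le_card[where n = "2 * k" and \<phi> = \<phi>]) (use assms in auto)
  finally show ?thesis by (simp add: field_simps power_divide)
qed

section \<open>The equation as a recurrence and its domain of dependence\<close>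

text \<open>The eigenvalue equation with all diagonal terms moved to the right-hand side, where
  \<open>coeff\<close> is the factor \<open>g\<close>. It can be solved for the value at the highest
  or at the lowest point in direction \<open>e\<close>.\<close>

definition solves :: "'d::finite \<Rightarrow> (int ^ 'd \<Rightarrow> real) \<Rightarrow> (int ^ 'd \<Rightarrow> complex) \<Rightarrow> bool" where
  "solves e g u \<longleftrightarrow>
    (\<forall>x. u (x + axis e 1) + u (x - axis e 1) + (\<Sum>y\<in>lateral e x. u y) = of_real (g x) * u x)"

lemma solves_forward:
  assumes "solves e g u"
  shows "u x = of_real (g (x - axis e 1)) * u (x - axis e 1) - u (x - axis e 1 - axis e 1)
    - (\<Sum>y\<in>lateral e (x - axis e 1). u y)"
  using assms[unfolded solves_def, rule_format, of "x - axis e 1"] by (simp add: algebra_simps)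

lemma solves_backward:
  assumes "solves e g u"
  shows "u x = of_real (g (x + axis e 1)) * u (x + axis e 1) - u (x + axis e 1 + axis e 1)
    - (\<Sum>y\<in>lateral e (x + axis e 1). u y)"
  using assms[unfolded solves_def, rule_format, of "x + axis e 1"] by (simp add: algebra_simps)

definition coeff :: "(int ^ 'd \<Rightarrow> real) \<Rightarrow> real \<Rightarrow> real \<Rightarrow> (int ^ 'd::finite \<Rightarrow> bool) \<Rightarrow> int ^ 'd \<Rightarrow> real" where
  "coeff V \<beta> lam \<omega> x = 2 * real CARD('d) + V x - lam + \<beta> * of_bool (\<omega> x)"

lemma abs_coeff_le:
  fixes V :: "int ^ 'd \<Rightarrow> real"
  assumes "0 \<le> V x" "V x \<le> h" "0 < \<beta>" "\<beta> \<le> 1" "- 1 \<le> lam" "lam \<le> 4 * real CARD('d) + 2"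
  shows "\<bar>coeff V \<beta> lam \<omega> x\<bar> \<le> 6 * real CARD('d) + h + 3"
proof -
  have "0 \<le> \<beta> * of_bool (\<omega> x)" "\<beta> * of_bool (\<omega> x) \<le> 1" using assms by auto
  then show ?thesis using assms unfolding coeff_def abs_le_iff by (intro conjI; linarith)
qed

lemma is_solution_solution: "is_solution V \<beta> e lam u0 \<omega> (solution V \<beta> e lam u0 \<omega>)"
  unfolding solution_def by (rule theI'[OF ex1_solution])

lemma solution_initial: "x $ e = 0 \<or> x $ e = 1 \<Longrightarrow> solution V \<beta> e lam u0 \<omega> x = u0 x"
  using is_solution_solution[of V \<beta> e lam u0 \<omega>] unfolding is_solution_iff_recurrence by blast

lemma solution_solves: "solves e (coeff V \<beta> lam \<omega>) (solution V \<beta> e lam u0 \<omega>)"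
  using is_solution_solution[of V \<beta> e lam u0 \<omega>]
  unfolding is_solution_iff_recurrence solves_def coeff_def by (simp add: algebra_simps)

text \<open>Finite domain of dependence. The number \<open>\<bar>2 * (x $ e) - 1\<bar>\<close>
  measures the distance to the data hyperplanes 0 and 1 symmetrically. Each use of the recurrence
  lowers it by at least 2 and moves by at most 2 in the l1-norm, so all coefficients used lie in the
  ball of that radius.\<close>

lemma solves_local:
  fixes u u' :: "int ^ 'd \<Rightarrow> complex"
  assumes sol: "solves e g u" and sol': "solves e g' u'"
    and init: "\<And>y. y $ e = 0 \<or> y $ e = 1 \<Longrightarrow> u y = u' y"
    and "\<And>y. l1 (y - x) \<le> \<bar>2 * (x $ e) - 1\<bar> \<Longrightarrow> g y = g' y"
  shows "u x = u' x"
  using assms(4)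
proof (induction "nat \<bar>2 * (x $ e) - 1\<bar>" arbitrary: x rule: less_induct)
  case less
  let ?s = "axis e 1 :: int ^ 'd"
  have tri: "l1 (y - x) \<le> l1 (y - z) + l1 (z - x)" for y z :: "int ^ 'd"
    unfolding l1_def sum.distrib[symmetric] by (rule sum_mono) auto
  have l1_s: "l1 (x - ?s - x) = 1" "l1 (x + ?s - x) = 1" "l1 (x - ?s - ?s - x) = 2" "l1 (x + ?s + ?s - x) = 2"
  proof -
    have "axis e (- 1) = - ?s" "axis e (- 2) = - ?s - ?s" "axis e 2 = ?s + ?s" by (simp_all add: vec_eq_iff axis_def)
    then show "l1 (x - ?s - x) = 1" "l1 (x + ?s - x) = 1" "l1 (x - ?s - ?s - x) = 2" "l1 (x + ?s + ?s - x) = 2"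
      using l1_axis[of e 1] l1_axis[of e "-1"] l1_axis[of e 2] l1_axis[of e "-2"] by auto
  qed
  have IH: "u z = u' z"
    if "\<bar>2 * (z $ e) - 1\<bar> + l1 (z - x) \<le> \<bar>2 * (x $ e) - 1\<bar>" "\<bar>2 * (z $ e) - 1\<bar> < \<bar>2 * (x $ e) - 1\<bar>" for z
  proof (rule less.hyps)
    fix y assume "l1 (y - z) \<le> \<bar>2 * (z $ e) - 1\<bar>"
    then show "g y = g' y" using tri[of y z] that by (intro less.prems) auto
  qed (use that in auto)
  have lat2: "l1 (y - x) \<le> 2" if "y \<in> lateral e z" "l1 (z - x) = 1" for y z
    using that tri[of y z] by (auto simp: lateral_def)
  consider "x $ e = 0 \<or> x $ e = 1" | "x $ e > 1" | "x $ e < 0" by linarith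
  then show ?case
  proof cases
    case 1 then show ?thesis by (simp add: init)
  next
    case 2
    have "g (x - ?s) = g' (x - ?s)" using 2 l1_s by (intro less.prems) auto
    moreover have "u (x - ?s) = u' (x - ?s)" "u (x - ?s - ?s) = u' (x - ?s - ?s)"
      by (rule IH; use 2 l1_s in simp)+
    moreover have "(\<Sum>y\<in>lateral e (x - ?s). u y) = (\<Sum>y\<in>lateral e (x - ?s). u' y)"
    proof (intro sum.cong refl IH)
      fix y assume y: "y \<in> lateral e (x - ?s)"
      then have "y $ e = x $ e - 1" by (simp add: lateral_def)
      then show "\<bar>2 * (y $ e) - 1\<bar> + l1 (y - x) \<le> \<bar>2 * (x $ e) - 1\<bar>"
        "\<bar>2 * (y $ e) - 1\<bar> < \<bar>2 * (x $ e) - 1\<bar>" using 2 lat2[OF y l1_s(1)] by auto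
    qed
    ultimately show ?thesis using solves_forward[OF sol, of x] solves_forward[OF sol', of x] by simp
  next
    case 3
    have "g (x + ?s) = g' (x + ?s)" using 3 l1_s by (intro less.prems) auto
    moreover have "u (x + ?s) = u' (x + ?s)" "u (x + ?s + ?s) = u' (x + ?s + ?s)"
      by (rule IH; use 3 l1_s in simp)+
    moreover have "(\<Sum>y\<in>lateral e (x + ?s). u y) = (\<Sum>y\<in>lateral e (x + ?s). u' y)"
    proof (intro sum.cong refl IH)
      fix y assume y: "y \<in> lateral e (x + ?s)"
      then have "y $ e = x $ e + 1" by (simp add: lateral_def)
      then show "\<bar>2 * (y $ e) - 1\<bar> + l1 (y - x) \<le> \<bar>2 * (x $ e) - 1\<bar>"
        "\<bar>2 * (y $ e) - 1\<bar> < \<bar>2 * (x $ e) - 1\<bar>" using 3 lat2[OF y l1_s(2)] by auto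
    qed
    ultimately show ?thesis using solves_backward[OF sol, of x] solves_backward[OF sol', of x] by simp
  qed
qed

section \<open>How changing one coefficient changes the solution\<close>

text \<open>Finite speed of propagation: solving upwards from the data hyperplanes, the coefficient
  at \<open>c\<close> first enters at \<open>c + axis e 1\<close>, and from there spreads sideways
  by at most one unit per unit of height.\<close>

lemma flip_outside_cone:
  fixes u u' :: "int ^ 'd \<Rightarrow> complex"
  assumes sol: "solves e g u" and sol': "solves e g' u'"
    and init: "\<And>y. y $ e = 0 \<or> y $ e = 1 \<Longrightarrow> u' y = u y"
    and off_c: "\<And>y. y \<noteq> c \<Longrightarrow> g' y = g y" and c_pos: "c $ e \<ge> 1"
    and "x $ e \<ge> 0" "x $ e \<le> c $ e + lat e (x - c)"
  shows "u' x = u x"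
  using assms(6-)
proof (induction "nat (x $ e)" arbitrary: x rule: less_induct)
  case less
  let ?s = "axis e 1 :: int ^ 'd"
  show ?case
  proof (cases "x $ e \<le> 1")
    case True
    then show ?thesis using less.prems by (intro init) auto
  next
    case False
    have lx: "lat e (x - ?s - c) = lat e (x - c)" "lat e (x - ?s - ?s - c) = lat e (x - c)"
      using lat_diff_axis[of e "x - c" 1] lat_diff_axis[of e "x - c - ?s" 1] by (simp_all add: algebra_simps)
    \<comment> \<open>Otherwise \<open>x\<close> would be the lowest point that the coefficient at
      \<open>c\<close> can influence, which lies just above the region considered.\<close>
    have "x - ?s \<noteq> c"
    proof
      assume "x - ?s = c"
      then have "lat e (x - c) = 0" "x $ e = c $ e + 1" using lx by (auto simp: lat_def)
      then show False using less.prems by simp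
    qed
    then have "g' (x - ?s) = g (x - ?s)" by (rule off_c)
    moreover have "u' (x - ?s) = u (x - ?s)" "u' (x - ?s - ?s) = u (x - ?s - ?s)"
      by (rule less.hyps; use False less.prems lx in auto)+
    moreover have "(\<Sum>y\<in>lateral e (x - ?s). u' y) = (\<Sum>y\<in>lateral e (x - ?s). u y)"
    proof (intro sum.cong refl less.hyps)
      fix y assume y: "y \<in> lateral e (x - ?s)"
      then have "y $ e = x $ e - 1" by (simp add: lateral_def)
      then show "nat (y $ e) < nat (x $ e)" "0 \<le> y $ e" "y $ e \<le> c $ e + lat e (y - c)"
        using lat_lateral[OF y, of c] lx False less.prems by auto
    qed
    ultimately show ?thesis using solves_forward[OF sol, of x] solves_forward[OF sol', of x] by simp
  qed
qed

text \<open>On the lowest layer that feels the change, the difference satisfies a recurrence of its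
  own: at \<open>x\<close> it is minus the sum of the differences at those lateral neighbours of
  \<open>x - axis e 1\<close> that are closer to \<open>c\<close>. Its sign depends only on the
  lateral distance to \<open>c\<close>, so nothing cancels, and \<open>M\<close> grows from the
  value 1 at the tip.\<close>

lemma flip_cone_boundary:
  fixes u u' :: "int ^ 'd \<Rightarrow> complex"
  assumes sol: "solves e g u" and sol': "solves e g' u'"
    and init: "\<And>y. y $ e = 0 \<or> y $ e = 1 \<Longrightarrow> u' y = u y"
    and off_c: "\<And>y. y \<noteq> c \<Longrightarrow> g' y = g y" and c_pos: "c $ e \<ge> 1"
    and "x $ e = c $ e + 1 + lat e (x - c)"
  shows "\<exists>M\<ge>1. u' x - u x =
    of_real ((- 1) ^ nat (lat e (x - c)) * M * (g' c - g c)) * u c"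
  using assms(6-)
proof (induction "nat (lat e (x - c))" arbitrary: x)
  case 0
  note outside = flip_outside_cone[OF sol sol' init off_c c_pos]
  let ?s = "axis e 1 :: int ^ 'd"
  from 0 have l0: "lat e (x - c) = 0" using lat_nonneg[of e "x - c"] by simp
  have xs: "x - ?s = c"
  proof -
    have "(x - ?s) $ i = c $ i" for i
      using 0 l0 component_le_lat[of i e "x - c"] by (cases "i = e") (auto simp: axis_def)
    then show ?thesis by (simp add: vec_eq_iff)
  qed
  have same: "u' c = u c" "u' (c - ?s) = u (c - ?s)"
    using c_pos lat_nonneg lat_nonneg[of e "c - ?s - c"] by (auto intro!: outside)
  have same_sum: "(\<Sum>y\<in>lateral e c. u' y) = (\<Sum>y\<in>lateral e c. u y)"
    using c_pos lat_nonneg by (intro sum.cong refl outside) (auto simp: lateral_def)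
  have "u x = of_real (g c) * u c - u (c - ?s) - (\<Sum>y\<in>lateral e c. u y)"
    using solves_forward[OF sol, of x] unfolding xs .
  moreover have "u' x = of_real (g' c) * u c - u (c - ?s) - (\<Sum>y\<in>lateral e c. u y)"
    using solves_forward[OF sol', of x] unfolding xs same same_sum .
  ultimately have "u' x - u x = of_real (g' c - g c) * u c"
    by (simp only: of_real_diff left_diff_distrib) simp
  then show ?case using l0 by (intro exI[of _ 1]) simp
next
  case (Suc r)
  note outside = flip_outside_cone[OF sol sol' init off_c c_pos]
  let ?s = "axis e 1 :: int ^ 'd"
  define D where "D = of_real (g' c - g c) * u c"
  have lr: "lat e (x - c) = int r + 1" using Suc(2) by linarith
  have lx: "lat e (x - ?s - c) = int r + 1" "lat e (x - ?s - ?s - c) = int r + 1"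
    using lr lat_diff_axis[of e "x - c" 1] lat_diff_axis[of e "x - c - ?s" 1] by (simp_all add: algebra_simps)
  have "x - ?s \<noteq> c" using lx(1) by (auto simp: lat_def)
  then have gx: "g' (x - ?s) = g (x - ?s)" by (rule off_c)
  have ux: "u' (x - ?s) = u (x - ?s)" "u' (x - ?s - ?s) = u (x - ?s - ?s)"
    by (rule outside; use lx lr Suc.prems c_pos in auto)+
  \<comment> \<open>A neighbour closer to \<open>c\<close> lies on the same layer and has
    \<open>M \<ge> 1\<close> by induction; a neighbour farther away lies outside the influence of
    \<open>c\<close> and gets \<open>M = 0\<close>.\<close>
  have "\<exists>M\<ge>0. u' y - u y = of_real ((- 1) ^ r * M) * D \<and> (lat e (y - c) = int r \<longrightarrow> M \<ge> 1)"
    if y: "y \<in> lateral e (x - ?s)" for y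
  proof -
    have ye: "y $ e = c $ e + 1 + int r" using y Suc.prems lr by (simp add: lateral_def)
    consider "lat e (y - c) = int r" | "lat e (y - c) = int r + 2"
      using lat_lateral[OF y, of c] lx by auto
    then show ?thesis
    proof cases
      case 1
      then obtain M where "M \<ge> 1" "u' y - u y = of_real ((- 1) ^ r * M * (g' c - g c)) * u c"
        using Suc.hyps(1)[of y] ye by auto
      then show ?thesis by (intro exI[of _ M]) (auto simp: D_def)
    next
      case 2
      then have "u' y = u y" using ye c_pos by (intro outside) auto
      then show ?thesis using 2 by (intro exI[of _ 0]) auto
    qed
  qed
  then obtain M where M: "\<And>y. y \<in> lateral e (x - ?s) \<Longrightarrow> M y \<ge> 0"
    "\<And>y. y \<in> lateral e (x - ?s) \<Longrightarrow> u' y - u y = of_real ((- 1) ^ r * M y) * D"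
    "\<And>y. y \<in> lateral e (x - ?s) \<Longrightarrow> lat e (y - c) = int r \<Longrightarrow> M y \<ge> (1 :: real)"
    by metis
  obtain y where y: "y \<in> lateral e (x - ?s)" "lat e (y - c) = int r"
    using lateral_closer[of e "x - ?s" c] lx by auto
  have "M y \<le> (\<Sum>y\<in>lateral e (x - ?s). M y)"
    using y M(1) by (intro member_le_sum finite_lateral) auto
  then have "1 \<le> (\<Sum>y\<in>lateral e (x - ?s). M y)" using M(3)[OF y] by simp
  moreover have "u' x - u x = - (\<Sum>y\<in>lateral e (x - ?s). u' y - u y)"
    using solves_forward[OF sol, of x] solves_forward[OF sol', of x] gx ux by (simp add: sum_subtractf)
  then have "u' x - u x = - (\<Sum>y\<in>lateral e (x - ?s). of_real ((- 1) ^ r * M y) * D)"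
    using M(2) by simp
  then have "u' x - u x = of_real ((- 1) ^ Suc r * (\<Sum>y\<in>lateral e (x - ?s). M y)) * D"
    by (simp add: sum_distrib_left sum_distrib_right sum_negf mult.assoc)
  ultimately show ?case using Suc(2)
    by (intro exI[of _ "\<Sum>y\<in>lateral e (x - ?s). M y"]) (simp add: D_def mult.assoc)
qed

section \<open>Large values on one of two consecutive cones\<close>

text \<open>
  The weight \<open>K ^ nat (x $ e)\<close> absorbs the constant lost in each use of the equation, since the
  value at \<open>x\<close> is computed from points with larger \<open>e\<close>-coordinate only.
\<close>

lemma shell_pair_large:
  fixes u :: "int ^ 'd \<Rightarrow> complex"
  assumes sol: "solves e g u"
    and K: "\<And>x. \<bar>g x\<bar> + 1 + real (card (lateral e (0 :: int ^ 'd))) \<le> K"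
    and m: "lat e p < m"
  shows "\<exists>x. x $ e \<ge> 1 \<and> (x $ e + lat e (x - p) = m \<or> x $ e + lat e (x - p) = m + 1) \<and>
    norm (u 0) \<le> K ^ nat (x $ e) * norm (u x)"
proof (rule ccontr)
  assume neg: "\<not> ?thesis"
  let ?s = "axis e 1 :: int ^ 'd"
  define t where "t x = x $ e + lat e (x - p)" for x
  define k where "k = real (card (lateral e (0 :: int ^ 'd)))"
  have K1: "K \<ge> 1" using K[of 0] abs_ge_zero[of "g 0"] by linarith
  have small: "K ^ nat (x $ e) * norm (u x) < norm (u 0)"
    if "x $ e \<ge> 1" "t x = m \<or> t x = m + 1" for x
  proof (rule ccontr)
    assume "\<not> ?thesis"
    then have "norm (u 0) \<le> K ^ nat (x $ e) * norm (u x)" by simp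
    then show False using neg that unfolding t_def by blast
  qed
  \<comment> \<open>Smallness on the cones \<open>m\<close> and \<open>m + 1\<close> descends to
    everything below: the value at \<open>x\<close> is computed from points one or two units higher,
    and at these \<open>t\<close> lies between \<open>t x\<close> and
    \<open>t x + 2\<close>.\<close>
  have main: "K ^ nat (x $ e) * norm (u x) < norm (u 0)"
    if "x $ e \<ge> 0" "t x < m \<or> x $ e \<ge> 1 \<and> t x \<le> m + 1" for x
    using that
  proof (induction "nat (m + 1 - x $ e)" arbitrary: x rule: less_induct)
    case less
    show ?case
    proof (cases "t x < m")
      case False
      then show ?thesis using less.prems by (intro small) auto
    next
      case True
      let ?n = "nat (x $ e)"
      let ?c = "norm (u 0)"
      have tx: "x $ e \<le> t x" using lat_nonneg[of e "x - p"] by (simp add: t_def)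
      have ts: "t (x + ?s) = t x + 1" "t (x + ?s + ?s) = t x + 2"
        using lat_add_axis[of e "x - p" 1] lat_add_axis[of e "x - p + ?s" 1]
        by (simp_all add: t_def algebra_simps)
      have z1: "K ^ Suc ?n * norm (u (x + ?s)) < ?c"
        using less.hyps[of "x + ?s"] less.prems ts True tx by (simp add: nat_add_distrib)
      have "K ^ Suc (Suc ?n) * norm (u (x + ?s + ?s)) < ?c"
        using less.hyps[of "x + ?s + ?s"] less.prems ts True tx by (simp add: nat_add_distrib)
      moreover have "K ^ Suc ?n * norm (u (x + ?s + ?s)) \<le> K ^ Suc (Suc ?n) * norm (u (x + ?s + ?s))"
        using K1 by (intro mult_right_mono power_increasing) auto
      ultimately have z2: "K ^ Suc ?n * norm (u (x + ?s + ?s)) < ?c" by linarith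
      have z3: "K ^ Suc ?n * norm (u y) \<le> ?c" if y: "y \<in> lateral e (x + ?s)" for y
      proof -
        have ye: "y $ e = x $ e + 1" using y by (simp add: lateral_def)
        have "t y = t x \<or> t y = t x + 2"
          using lat_lateral[OF y, of p] ye ts(1) by (auto simp: t_def)
        then show ?thesis
          using less.hyps[of y] less.prems True ye tx by (auto simp: nat_add_distrib less_imp_le)
      qed
      have "norm (u x) \<le> norm (of_real (g (x + ?s)) * u (x + ?s)) + norm (u (x + ?s + ?s))
          + norm (\<Sum>y\<in>lateral e (x + ?s). u y)"
        by (subst solves_backward[OF sol]) (meson norm_triangle_ineq4 order_trans add_right_mono)
      also have "\<dots> \<le> \<bar>g (x + ?s)\<bar> * norm (u (x + ?s)) + norm (u (x + ?s + ?s))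
          + (\<Sum>y\<in>lateral e (x + ?s). norm (u y))"
        using norm_sum[of u "lateral e (x + ?s)"] by (simp add: norm_mult)
      finally have "K ^ Suc ?n * norm (u x) \<le> K ^ Suc ?n *
          (\<bar>g (x + ?s)\<bar> * norm (u (x + ?s)) + norm (u (x + ?s + ?s))
          + (\<Sum>y\<in>lateral e (x + ?s). norm (u y)))"
        using K1 by (intro mult_left_mono) auto
      also have "\<dots> = \<bar>g (x + ?s)\<bar> * (K ^ Suc ?n * norm (u (x + ?s)))
          + K ^ Suc ?n * norm (u (x + ?s + ?s))
          + (\<Sum>y\<in>lateral e (x + ?s). K ^ Suc ?n * norm (u y))"
        by (simp only: distrib_left sum_distrib_left mult.left_commute)
      \<comment> \<open>The strict inequality comes from the term at \<open>x + ?s + ?s\<close>,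
        whose coefficient is 1; the factor \<open>\<bar>g (x + ?s)\<bar>\<close> may vanish and the
        lateral sum may be empty.\<close>
      also have "\<dots> < \<bar>g (x + ?s)\<bar> * ?c + ?c + k * ?c"
      proof -
        have "\<bar>g (x + ?s)\<bar> * (K ^ Suc ?n * norm (u (x + ?s))) \<le> \<bar>g (x + ?s)\<bar> * ?c"
          using z1 by (intro mult_left_mono) auto
        moreover have "(\<Sum>y\<in>lateral e (x + ?s). K ^ Suc ?n * norm (u y)) \<le> k * ?c"
          using sum_bounded_above[of "lateral e (x + ?s)", OF z3] by (simp add: card_lateral[of e "x + ?s"] k_def)
        ultimately show ?thesis using z2 by linarith
      qed
      also have "\<dots> = (\<bar>g (x + ?s)\<bar> + 1 + k) * ?c" by (simp add: algebra_simps)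
      also have "\<dots> \<le> K * ?c" using K[of "x + ?s"] by (intro mult_right_mono) (auto simp: k_def)
      finally have "K * (K ^ ?n * norm (u x)) < K * ?c" by (simp add: mult.assoc)
      then show ?thesis using K1 by simp
    qed
  qed
  \<comment> \<open>The origin lies below both cones and has weight \<open>K^0 = 1\<close>, so the
    claim there reads \<open>norm (u 0) < norm (u 0)\<close>.\<close>
  have "t 0 < m" using m lat_commute[of e 0 p] by (simp add: t_def)
  then show False using main[of 0] by simp
qed

section \<open>Coin tosses along one column\<close>

text \<open>Applies \<open>card_few_successes\<close> to the column above \<open>p\<close>: the
  proportion of configurations with at most \<open>z\<close> large values among the
  \<open>2 * k\<close> column points is at most \<open>2^z * (3/4)^k\<close>. Only coins on the
  cones met on the way are flipped, and these lie in \<open>J\<close>.\<close>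

lemma column_tail:
  fixes e :: "'d::finite" and p :: "int ^ 'd" and q k :: nat and \<delta> :: real
    and u :: "(int ^ 'd \<Rightarrow> bool) \<Rightarrow> int ^ 'd \<Rightarrow> complex"
  defines "A \<equiv> \<lambda>i \<omega>. \<delta> * norm (u \<omega> 0) \<le> norm (u \<omega> (p + axis e (int q + 2 + int i)))"
  assumes sol: "\<And>\<omega>. solves e (\<lambda>x. G x + \<beta> * of_bool (\<omega> x)) (u \<omega>)"
    and init: "\<And>\<omega> x. x $ e = 0 \<or> x $ e = 1 \<Longrightarrow> u \<omega> x = u0 x"
    and K: "\<And>\<omega> x. \<bar>G x + \<beta> * of_bool (\<omega> x)\<bar> + 1 + real (card (lateral e (0 :: int ^ 'd))) \<le> K"
    and "\<beta> > 0" and pe: "p $ e = 0" and pq: "lat e p \<le> int q"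
    and \<delta>: "2 * \<delta> * K ^ (q + 2 * k) \<le> \<beta>"
    and J: "\<And>x. x $ e \<ge> 1 \<Longrightarrow> x $ e + lat e (x - p) \<le> int (q + 2 * k) \<Longrightarrow> x \<in> J"
    and fin: "finite {\<omega>. \<forall>x. x \<notin> J \<longrightarrow> \<omega> x = \<eta> x}" (is "finite ?\<Omega>")
  shows "real (card {\<omega>\<in>{\<omega>. \<forall>x. x \<notin> J \<longrightarrow> \<omega> x = \<eta> x}. card {i. i < 2 * k \<and> A i \<omega>} \<le> z}) * (4/3) ^ k
    \<le> 2 ^ z * real (card {\<omega>. \<forall>x. x \<notin> J \<longrightarrow> \<omega> x = \<eta> x})"
proof -
  define t where "t x = x $ e + lat e (x - p)" for x
  \<comment> \<open>Cone number \<open>q + 1 + i\<close> lies above the origin because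
    \<open>lat e p \<le> q\<close>. The point tested in \<open>A i\<close> has height
    \<open>q + 2 + i\<close>, so it is the column point of the next cone.\<close>
  define P where "P i \<omega> x \<longleftrightarrow> x $ e \<ge> 1 \<and> t x = int q + 1 + int i \<and>
    norm (u \<omega> 0) \<le> K ^ nat (x $ e) * norm (u \<omega> x)" for i :: nat and \<omega> x
  define X where "X i \<omega> = (\<exists>x. P i \<omega> x)" for i \<omega>
  \<comment> \<open>The choice is a function of the predicate \<open>P i \<omega>\<close> alone.
    That predicate survives the flip, so the same point is chosen again and \<open>\<phi> i\<close>
    is an involution.\<close>
  define C where "C i \<omega> = (SOME x. P i \<omega> x)" for i \<omega>
  define \<phi> where "\<phi> i \<omega> = (if X i \<omega> then fun_upd \<omega> (C i \<omega>) (\<not> \<omega> (C i \<omega>)) else \<omega>)" for i \<omega>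
  have C: "P i \<omega> (C i \<omega>)" if "X i \<omega>" for i \<omega>
    using that unfolding X_def C_def by (rule someI_ex)
  have u_zero: "u \<omega> 0 = u0 0" for \<omega> by (rule init) simp
  have u_inv: "u (\<phi> i \<omega>) x = u \<omega> x" if "x $ e \<ge> 0" "t x \<le> int q + 1 + int i" for i \<omega> x
  proof (cases "X i \<omega>")
    case True
    let ?c = "C i \<omega>"
    have c: "?c $ e \<ge> 1" "t ?c = int q + 1 + int i" using C[OF True] by (auto simp: P_def)
    \<comment> \<open>Points on the cone of \<open>?c\<close> or below it are out of reach of the
      coin at \<open>?c\<close>, by the triangle inequality for \<open>lat\<close>.\<close>
    have "x $ e \<le> ?c $ e + lat e (x - ?c)"
      using c(2) that(2) lat_triangle[of e ?c p x] lat_commute[of e ?c x] by (simp add: t_def)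
    with c(1) that(1) True show ?thesis
      by - (rule flip_outside_cone[OF sol[of \<omega>] sol[of "\<phi> i \<omega>"], where c = ?c],
        simp_all add: init \<phi>_def)
  qed (simp add: \<phi>_def)
  have P_inv: "P j (\<phi> i \<omega>) = P j \<omega>" if "j \<le> i" for i j \<omega>
    unfolding P_def u_zero using u_inv[of _ i \<omega>] that by (intro ext) auto
  have X_inv: "X j (\<phi> i \<omega>) = X j \<omega>" if "j \<le> i" for i j \<omega>
    unfolding X_def using P_inv[OF that] by simp
  have C_inv: "C i (\<phi> i \<omega>) = C i \<omega>" for i \<omega> unfolding C_def by (simp add: P_inv)
  have "real (card {\<omega>\<in>?\<Omega>. card {i. i < 2 * k \<and> A i \<omega>} \<le> z}) * (4/3) ^ k \<le> 2 ^ z * real (card ?\<Omega>)"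
  proof (rule card_few_successes[where X = X and \<phi> = \<phi>, OF fin])
    fix i \<omega> assume i: "i < 2 * k" and w: "\<omega> \<in> ?\<Omega>"
    have "C i \<omega> \<in> J" if "X i \<omega>" using C[OF that] i by (intro J) (auto simp: P_def t_def)
    then show "\<phi> i \<omega> \<in> ?\<Omega>" using w by (auto simp: \<phi>_def)
    show "\<phi> i (\<phi> i \<omega>) = \<omega>"
    proof (cases "X i \<omega>")
      case True
      have "\<phi> i (\<phi> i \<omega>) = fun_upd (\<phi> i \<omega>) (C i \<omega>) (\<not> \<phi> i \<omega> (C i \<omega>))"
        using True X_inv[of i i \<omega>] C_inv[of i \<omega>] by (simp add: \<phi>_def[of i "\<phi> i \<omega>"])
      then show ?thesis using True by (simp add: \<phi>_def)
    qed (simp add: \<phi>_def)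
    show "X j (\<phi> i \<omega>) = X j \<omega>" if "j \<le> i" for j by (rule X_inv[OF that])
    show "A j (\<phi> i \<omega>) = A j \<omega>" if "j < i" for j
    proof -
      have "lat e (axis e (int q + 2 + int j) :: int ^ 'd) = 0"
        by (auto simp: lat_def axis_def)
      then have "u (\<phi> i \<omega>) (p + axis e (int q + 2 + int j)) = u \<omega> (p + axis e (int q + 2 + int j))"
        using that pe by (intro u_inv) (auto simp: t_def axis_def)
      then show ?thesis by (simp add: A_def u_zero)
    qed
    show "A i \<omega> \<or> A i (\<phi> i \<omega>)" if X: "X i \<omega>"
    proof -
      let ?c = "C i \<omega>" and ?y = "p + axis e (int q + 2 + int i)"
      have c: "?c $ e \<ge> 1" "t ?c = int q + 1 + int i"
        "norm (u \<omega> 0) \<le> K ^ nat (?c $ e) * norm (u \<omega> ?c)"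
        using C[OF X] by (auto simp: P_def)
      have K1: "K \<ge> 1" using K[of 0 \<omega>] abs_ge_zero[of "G 0 + \<beta> * of_bool (\<omega> 0)"] by linarith
      have "lat e (?y - ?c) = lat e (?c - p)"
        using lat_add_axis[of e "p - ?c"] lat_commute[of e p ?c] by (simp add: algebra_simps)
      \<comment> \<open>The column point lies exactly on the lowest layer influenced by
        \<open>?c\<close>, where the effect of the flip is known up to the factor
        \<open>M\<close>.\<close>
      then have "?y $ e = ?c $ e + 1 + lat e (?y - ?c)" using c(2) pe by (simp add: t_def axis_def)
      then obtain M where M: "M \<ge> 1" "u (\<phi> i \<omega>) ?y - u \<omega> ?y =
          of_real ((- 1) ^ nat (lat e (?y - ?c)) * M * ((G ?c + \<beta> * of_bool ((\<phi> i \<omega>) ?c)) - (G ?c + \<beta> * of_bool (\<omega> ?c)))) * u \<omega> ?c"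
        using flip_cone_boundary[OF sol[of \<omega>] sol[of "\<phi> i \<omega>"], where c = ?c and x = ?y] c(1) X by (auto simp: \<phi>_def init)
      have "\<bar>(G ?c + \<beta> * of_bool ((\<phi> i \<omega>) ?c)) - (G ?c + \<beta> * of_bool (\<omega> ?c))\<bar> = \<beta>" using X \<open>\<beta> > 0\<close> by (auto simp: \<phi>_def)
      then have "norm (u (\<phi> i \<omega>) ?y - u \<omega> ?y) = M * \<beta> * norm (u \<omega> ?c)"
        using M(1) by (simp only: M(2) norm_mult norm_of_real abs_mult power_abs) simp
      moreover have "\<beta> * norm (u \<omega> ?c) \<le> M * \<beta> * norm (u \<omega> ?c)"
        using M(1) \<open>\<beta> > 0\<close> by (intro mult_right_mono) auto
      \<comment> \<open>The flip moves the value at \<open>?y\<close> by at least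
        \<open>2 * \<delta> * norm (u \<omega> 0)\<close>, so the old and the new value cannot both
        be below \<open>\<delta> * norm (u \<omega> 0)\<close>.\<close>
      moreover have "2 * \<delta> * norm (u \<omega> 0) \<le> \<beta> * norm (u \<omega> ?c)"
      proof (cases "\<delta> \<le> 0")
        case True
        then have "2 * \<delta> * norm (u \<omega> 0) \<le> 0" by (simp add: mult_nonpos_nonneg)
        also have "0 \<le> \<beta> * norm (u \<omega> ?c)" using \<open>\<beta> > 0\<close> by simp
        finally show ?thesis .
      next
        case False
        \<comment> \<open>Since \<open>i < 2 * k\<close>, the cone number \<open>q + 1 + i\<close>
          is at most \<open>q + 2 * k\<close>, the exponent in the condition on
          \<open>\<delta>\<close>.\<close>
        have "nat (?c $ e) \<le> q + 2 * k"
          using c(2) i lat_nonneg[of e "?c - p"] by (simp add: t_def)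
        then have "K ^ nat (?c $ e) \<le> K ^ (q + 2 * k)" using K1 by (rule power_increasing)
        then have "norm (u \<omega> 0) \<le> K ^ (q + 2 * k) * norm (u \<omega> ?c)"
          using c(3) by (meson mult_right_mono norm_ge_zero order_trans)
        then have "2 * \<delta> * norm (u \<omega> 0) \<le> 2 * \<delta> * (K ^ (q + 2 * k) * norm (u \<omega> ?c))"
          using False by (intro mult_left_mono) auto
        also have "\<dots> \<le> \<beta> * norm (u \<omega> ?c)"
          using mult_right_mono[OF \<delta>, of "norm (u \<omega> ?c)"] by (simp add: mult.assoc)
        finally show ?thesis .
      qed
      moreover have "norm (u (\<phi> i \<omega>) ?y - u \<omega> ?y) \<le> norm (u (\<phi> i \<omega>) ?y) + norm (u \<omega> ?y)"
        by (rule norm_triangle_ineq4)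
      ultimately show ?thesis unfolding A_def u_zero by linarith
    qed
  next
    fix i \<omega>
    have "lat e p < int q + 1 + int i" using pq by simp
    then obtain x where "x $ e \<ge> 1"
      "x $ e + lat e (x - p) = int q + 1 + int i \<or> x $ e + lat e (x - p) = int q + 1 + int i + 1"
      "norm (u \<omega> 0) \<le> K ^ nat (x $ e) * norm (u \<omega> x)"
      using shell_pair_large[OF sol[of \<omega>], of K p "int q + 1 + int i"] K \<open>lat e p < _\<close> by blast
    then have "P i \<omega> x \<or> P (Suc i) \<omega> x" by (auto simp: P_def t_def)
    then show "X i \<omega> \<or> X (Suc i) \<omega>" by (auto simp: X_def)
  qed
  then show ?thesis .
qed

section \<open>Counting points in boxes and cubes\<close>

lemma box_bij: "bij_betw vec_nth {x :: int ^ 'd. \<forall>i. x $ i \<in> B i} (PiE UNIV B)"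
  by (rule bij_betwI[of _ _ _ vec_lambda]) auto

lemma finite_box: "(\<And>i. finite (B i)) \<Longrightarrow> finite {x :: int ^ 'd. \<forall>i. x $ i \<in> B i}"
  using bij_betw_finite[OF box_bij[of B]] by (simp add: finite_PiE)

lemma card_box: "card {x :: int ^ 'd. \<forall>i. x $ i \<in> B i} = (\<Prod>i\<in>UNIV. card (B i))"
  using bij_betw_same_card[OF box_bij[of B]] by (simp add: card_PiE)

lemma cube_iff: "x \<in> cube L \<longleftrightarrow> (\<forall>i. real_of_int \<bar>x $ i\<bar> \<le> L)"
  unfolding cube_def linf_def mem_Collect_eq le_floor_iff[symmetric]
  by (subst Max_le_iff) (auto simp: le_floor_iff)

lemma finite_cube: "finite (cube L :: (int ^ 'd) set)"
proof (rule finite_subset)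
  show "(cube L :: (int ^ 'd) set) \<subseteq> {x. \<forall>i. x $ i \<in> {- \<lfloor>L\<rfloor>..\<lfloor>L\<rfloor>}}"
  proof
    fix x :: "int ^ 'd" assume x: "x \<in> cube L"
    have "\<bar>x $ i\<bar> \<le> \<lfloor>L\<rfloor>" for i using x unfolding cube_iff le_floor_iff by blast
    then show "x \<in> {x. \<forall>i. x $ i \<in> {- \<lfloor>L\<rfloor>..\<lfloor>L\<rfloor>}}" by (auto simp: abs_le_iff minus_le_iff)
  qed
qed (rule finite_box, simp)

section \<open>The union bound over all columns\<close>

text \<open>For \<open>x\<close> in the cube of radius \<open>L\<close>, the ball of dependence in
  \<open>solves_local\<close> has radius at most \<open>2 * L + 1\<close>, so its points have
  coordinates of absolute value at most \<open>3 * L + 1\<close>.\<close>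

lemma uc_event_local:
  fixes \<omega> \<omega>' :: "int ^ 'd \<Rightarrow> bool"
  assumes "L \<ge> 0" and "\<And>y. y \<in> cube (3 * L + 1) \<Longrightarrow> \<omega> y = \<omega>' y"
  shows "\<omega> \<in> uc_event V \<beta> e \<epsilon> C1 L u0 lam \<longleftrightarrow> \<omega>' \<in> uc_event V \<beta> e \<epsilon> C1 L u0 lam"
proof -
  have "solution V \<beta> e lam u0 \<omega> x = solution V \<beta> e lam u0 \<omega>' x" if x: "x \<in> cube L" for x
  proof (rule solves_local[OF solution_solves solution_solves])
    fix y :: "int ^ 'd" assume y: "l1 (y - x) \<le> \<bar>2 * x $ e - 1\<bar>"
    have "real_of_int \<bar>y $ i\<bar> \<le> 3 * L + 1" for i
    proof -
      have "\<bar>(y - x) $ i\<bar> \<le> l1 (y - x)" unfolding l1_def by (rule member_le_sum) auto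
      then have "\<bar>y $ i\<bar> \<le> \<bar>x $ i\<bar> + (2 * \<bar>x $ e\<bar> + 1)" using y by auto
      moreover have "real_of_int \<bar>x $ i\<bar> \<le> L" "real_of_int \<bar>x $ e\<bar> \<le> L" using x cube_iff by blast+
      ultimately show ?thesis by linarith
    qed
    then have "\<omega> y = \<omega>' y" by (intro assms(2)) (simp add: cube_iff)
    then show "coeff V \<beta> lam \<omega> y = coeff V \<beta> lam \<omega>' y" by (simp add: coeff_def)
  qed (simp add: solution_initial)
  moreover have "(0 :: int ^ 'd) \<in> cube L" using assms(1) by (simp add: cube_iff)
  ultimately show ?thesis unfolding uc_event_def mem_Collect_eq
    by (intro ex_cong1 conj_cong refl ball_cong arg_cong2[where f = "(\<le>)"]) auto
qed

text \<open>The integer \<open>r\<close> is the scale with \<open>L\<close> about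
  \<open>64 * D * r\<close>. The columns stand over a box of radius \<open>r\<close>, each is tested
  at \<open>q = 16 * D * r\<close> heights, and a column is bad if at most \<open>D * r\<close>
  values are large. If no column is bad, the large values fill a positive fraction of the
  cube.\<close>

lemma few_bad_configs:
  fixes J :: "(int ^ 'd) set" and r :: nat and L C1 :: real
    and u :: "(int ^ 'd \<Rightarrow> bool) \<Rightarrow> int ^ 'd \<Rightarrow> complex"
  defines "D \<equiv> CARD('d)"
  defines "\<epsilon> \<equiv> (1 / (512 * real D)) ^ D"
  defines "E \<equiv> {\<omega>. \<exists>T\<subseteq>cube L. \<epsilon> * L ^ CARD('d) \<le> real (card T) \<and>
      (\<forall>n\<in>T. exp (- C1 * L) * norm (u \<omega> 0) \<le> norm (u \<omega> n))}"
  assumes sol: "\<And>\<omega>. solves e (\<lambda>x. G x + \<beta> * of_bool (\<omega> x)) (u \<omega>)"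
    and init: "\<And>\<omega> x. x $ e = 0 \<or> x $ e = 1 \<Longrightarrow> u \<omega> x = u0 x"
    and K: "\<And>\<omega> x. \<bar>G x + \<beta> * of_bool (\<omega> x)\<bar> + 1 + real (card (lateral e (0 :: int ^ 'd))) \<le> K"
    and "\<beta> > 0" and r: "r \<ge> 1" and L: "64 * real D * real r \<le> L" "L \<le> 64 * real D * (real r + 1)"
    and C1: "2 * exp (- C1 * L) * K ^ (32 * D * r) \<le> \<beta>"
    and J: "cube L \<subseteq> J" "finite J"
  shows "real (card ({\<omega>. \<forall>x. x \<notin> J \<longrightarrow> \<omega> x = \<eta> x} - E))
    \<le> exp (- \<epsilon> * L) * real (card {\<omega>. \<forall>x. x \<notin> J \<longrightarrow> \<omega> x = \<eta> x})"
proof -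
  let ?\<Omega> = "{\<omega>. \<forall>x. x \<notin> J \<longrightarrow> \<omega> x = \<eta> x}"
  define q where "q = 16 * D * r"
  define P where "P = {p :: int ^ 'd. \<forall>i. p $ i \<in> (if i = e then {0} else {- int r..int r})}"
  define A where "A p \<omega> i \<longleftrightarrow>
    exp (- C1 * L) * norm (u \<omega> 0) \<le> norm (u \<omega> (p + axis e (int q + 2 + int i)))" for p \<omega> and i :: nat
  define I where "I p \<omega> = {i. i < q \<and> A p \<omega> i}" for p \<omega>
  define Bad where "Bad p = {\<omega>\<in>?\<Omega>. card (I p \<omega>) \<le> D * r}" for p
  obtain d' where d': "D = Suc d'" unfolding D_def using gr0_conv_Suc[of "CARD('d)"] by auto
  have fin\<Omega>: "finite ?\<Omega>" using J(2) by (rule finite_configs)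
  have finP: "finite P" unfolding P_def by (rule finite_box) auto
  have cardP: "card P = (2 * r + 1) ^ d'"
  proof -
    have "card P = (\<Prod>i\<in>UNIV. card (if i = e then {0} else {- int r..int r}))"
      unfolding P_def by (rule card_box)
    also have "\<dots> = (\<Prod>i\<in>UNIV - {e}. card (if i = e then {0} else {- int r..int r}))"
      by (subst prod.remove[of _ e]) auto
    also have "\<dots> = (\<Prod>i\<in>UNIV - {e}. 2 * r + 1)" by (rule prod.cong) auto
    finally show ?thesis using d' by (simp add: D_def)
  qed
  have P_e: "p $ e = 0" and P_abs: "\<bar>p $ i\<bar> \<le> int r" if "p \<in> P" for p i
    using that by (auto simp: P_def split: if_splits dest!: spec[of _ e] spec[of _ i])
  have lat_P: "lat e p \<le> int q" if p: "p \<in> P" for p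
  proof -
    have "lat e p \<le> int (card (UNIV - {e})) * int r"
      unfolding lat_def using sum_bounded_above[of "UNIV - {e}" "\<lambda>i. \<bar>p $ i\<bar>" "int r"] P_abs[OF p] by simp
    also have "\<dots> = int (d' * r)" using d' by (simp add: D_def)
    also have "\<dots> \<le> int q" unfolding q_def d' of_nat_le_iff by (intro mult_right_mono) auto
    finally show ?thesis .
  qed
  have qL: "real (4 * q) \<le> L" using L(1) by (simp add: q_def mult.assoc)
  have to_L: "real_of_int z \<le> L" if "z \<le> int (4 * q)" for z
    using of_int_le_iff[of z "int (4 * q)", where 'a = real] that qL by simp
  have rq: "r \<le> q" "1 \<le> q" using r d' by (auto simp: q_def)
  have Bad: "real (card (Bad p)) \<le> (1/4) ^ (D * r) * real (card ?\<Omega>)" if p: "p \<in> P" for p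
  proof -
    \<comment> \<open>This rewriting brings \<open>q\<close> into the form \<open>2 * k\<close> with
      \<open>k = 8 * D * r\<close>, so the number of heights and the initial offset agree.\<close>
    have "2 * (8 * D * r) = q" by (simp add: q_def)
    then have "real (card (Bad p)) * (4/3) ^ (8 * D * r) \<le> 2 ^ (D * r) * real (card ?\<Omega>)"
      unfolding Bad_def I_def A_def
    proof (elim subst, intro column_tail[where u = u and G = G and e = e and \<beta> = \<beta> and K = K, OF sol init _ \<open>\<beta> > 0\<close> P_e[OF p]])
      show "\<bar>G x + \<beta> * of_bool (\<omega> x)\<bar> + 1 + real (card (lateral e (0 :: int ^ 'd))) \<le> K" for x \<omega>
        by (rule K)
      show "lat e p \<le> int (2 * (8 * D * r))" using lat_P[OF p] by (simp add: q_def)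
      show "2 * exp (- C1 * L) * K ^ (2 * (8 * D * r) + 2 * (8 * D * r)) \<le> \<beta>" using C1 by (simp add: mult.assoc)
      fix x :: "int ^ 'd"
      assume x: "1 \<le> x $ e" "x $ e + lat e (x - p) \<le> int (2 * (8 * D * r) + 2 * (8 * D * r))"
      have "\<bar>x $ i\<bar> \<le> int (4 * q)" for i
      proof (cases "i = e")
        case True
        then show ?thesis using x lat_nonneg[of e "x - p"] by (simp add: q_def)
      next
        case False
        then have "\<bar>x $ i - p $ i\<bar> \<le> int (2 * q)"
          using component_le_lat[of i e "x - p"] x by (simp add: q_def)
        then show ?thesis using P_abs[OF p, of i] rq by linarith
      qed
      then have "real_of_int \<bar>x $ i\<bar> \<le> L" for i by (intro to_L)
      then show "x \<in> J" using J(1) cube_iff by blast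
    qed (use fin\<Omega> in auto)
    \<comment> \<open>The choice \<open>k = 8 * z\<close> with \<open>z = D * r\<close> works
      because \<open>(4/3)^8 > 8 = 2 * 4\<close>.\<close>
    moreover have "(2 :: real) ^ (D * r) \<le> (1/4) ^ (D * r) * (4/3) ^ (8 * D * r)"
    proof -
      have "(2 :: real) ^ (D * r) \<le> (1/4 * (4/3) ^ 8) ^ (D * r)"
        by (intro power_mono) (auto simp: power_divide)
      also have "\<dots> = (1/4) ^ (D * r) * (4/3) ^ (8 * D * r)"
        by (simp only: power_mult_distrib power_mult[symmetric] mult.assoc)
      finally show ?thesis .
    qed
    then have "2 ^ (D * r) * real (card ?\<Omega>) \<le>
        (1/4) ^ (D * r) * (4/3) ^ (8 * D * r) * real (card ?\<Omega>)" by (rule mult_right_mono) simp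
    ultimately have "real (card (Bad p)) * (4/3) ^ (8 * D * r) \<le>
        (1/4) ^ (D * r) * real (card ?\<Omega>) * (4/3) ^ (8 * D * r)"
      by (simp only: mult.assoc mult.commute[of "real (card ?\<Omega>)"])
    then show ?thesis by (rule mult_right_le_imp_le) simp
  qed
  have good: "\<omega> \<in> E" if w: "\<omega> \<in> ?\<Omega>" "\<omega> \<notin> (\<Union>p\<in>P. Bad p)" for \<omega>
  proof -
    define f where "f = (\<lambda>(p :: int ^ 'd, i). p + axis e (int q + 2 + int i))"
    define T where "T = f ` (SIGMA p:P. I p \<omega>)"
    have "inj_on f (SIGMA p:P. I p \<omega>)"
    proof (rule inj_onI, clarify)
      fix p i p' i' assume *: "p \<in> P" "p' \<in> P" "f (p, i) = f (p', i')"
      then have "f (p, i) $ e = f (p', i') $ e" by simp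
      then have "i = i'" using * P_e by (simp add: f_def axis_def)
      then show "p = p' \<and> i = i'" using * by (simp add: f_def)
    qed
    then have "card T = (\<Sum>p\<in>P. card (I p \<omega>))"
      unfolding T_def using finP by (simp add: card_image card_SigmaI I_def)
    moreover have "(\<Sum>p\<in>P. card (I p \<omega>)) \<ge> (\<Sum>p\<in>P. D * r)"
      using w by (intro sum_mono) (auto simp: Bad_def not_le less_imp_le)
    ultimately have cardT: "card T \<ge> (2 * r + 1) ^ d' * (D * r)" by (simp add: cardP)
    \<comment> \<open>The constant \<open>512 = 64 * 8\<close> turns
      \<open>L \<le> 64 * D * (r + 1)\<close> into \<open>L / (512 * D) \<le> (r + 1) / 8\<close>,
      which leaves room in every factor of the lower bound for \<open>card T\<close>.\<close>
    have "\<epsilon> * L ^ D = (L / (512 * real D)) ^ D"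
      by (simp add: \<epsilon>_def power_divide)
    also have "\<dots> \<le> ((real r + 1) / 8) ^ D"
      using L d' qL by (intro power_mono) (auto simp: field_simps)
    also have "\<dots> = ((real r + 1) / 8) ^ d' * ((real r + 1) / 8)" by (simp add: d')
    also have "\<dots> \<le> (2 * real r + 1) ^ d' * (real D * real r)"
    proof (intro mult_mono power_mono)
      have "(real r + 1) / 8 \<le> real r" using r by simp
      also have "\<dots> \<le> real D * real r" by (simp add: d' distrib_right)
      finally show "(real r + 1) / 8 \<le> real D * real r" .
    qed auto
    also have "\<dots> = real ((2 * r + 1) ^ d' * (D * r))" by (simp add: add.commute)
    also have "\<dots> \<le> real (card T)" using cardT of_nat_le_iff by blast
    finally have "\<epsilon> * L ^ CARD('d) \<le> real (card T)" by (simp add: D_def)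
    moreover have "T \<subseteq> cube L"
    proof
      fix x assume "x \<in> T"
      then obtain p i where x: "p \<in> P" "i < q" "x = p + axis e (int q + 2 + int i)"
        by (auto simp: T_def f_def I_def)
      have "\<bar>x $ j\<bar> \<le> int (4 * q)" for j
        using P_abs[OF x(1), of j] P_e[OF x(1)] x(2,3) rq by (cases "j = e") (auto simp: axis_def)
      then have "real_of_int \<bar>x $ j\<bar> \<le> L" for j by (intro to_L)
      then show "x \<in> cube L" by (simp add: cube_iff)
    qed
    moreover have "\<forall>n\<in>T. norm (u \<omega> n) \<ge> exp (- C1 * L) * norm (u \<omega> 0)"
      by (auto simp: T_def f_def I_def A_def)
    ultimately show ?thesis unfolding E_def mem_Collect_eq by blast
  qed
  have "real (card (?\<Omega> - E)) \<le> real (card (\<Union>p\<in>P. Bad p))"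
    unfolding of_nat_le_iff using finP fin\<Omega> good by (intro card_mono) (auto simp: Bad_def)
  also have "\<dots> \<le> (\<Sum>p\<in>P. real (card (Bad p)))"
    using card_UN_le[OF finP, of Bad] by (metis of_nat_le_iff of_nat_sum)
  also have "\<dots> \<le> (\<Sum>p\<in>P. (1/4) ^ (D * r) * real (card ?\<Omega>))" by (intro sum_mono Bad)
  also have "\<dots> = (2 * real r + 1) ^ d' * (1/4) ^ (D * r) * real (card ?\<Omega>)" by (simp add: cardP add.commute)
  also have "\<dots> \<le> exp (- \<epsilon> * L) * real (card ?\<Omega>)"
  proof (rule mult_right_mono)
    have "(2 * real r + 1) ^ d' * (1/4) ^ (D * r) \<le> exp (- (real D * real r / 4))"
      using power_tail_bound[of r d'] by (simp only: d')
    also have "\<dots> \<le> exp (- \<epsilon> * L)"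
    proof -
      have "\<epsilon> \<le> (1 / (512 * real D)) ^ 1"
        unfolding \<epsilon>_def by (intro power_decreasing) (auto simp: d' field_simps)
      then have "\<epsilon> * L \<le> 1 / (512 * real D) * L" using qL by (intro mult_right_mono) auto
      also have "\<dots> \<le> (real r + 1) / 8" using L(2) by (simp add: d' field_simps)
      also have "\<dots> \<le> real r / 4" using r by simp
      also have "\<dots> \<le> real D * real r / 4" by (simp add: d' field_simps)
      finally show ?thesis by simp
    qed
    finally show "(2 * real r + 1) ^ d' * (1/4) ^ (D * r) \<le> exp (- \<epsilon> * L)" .
  qed simp
  finally show ?thesis .
qed

text \<open>Converts the count of bad configurations into a probability. The set \<open>J\<close>
  stays free so that the bound serves both for coins frozen outside the cube and for the full
  measure.\<close>

lemma prob_override_uc_event: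
  fixes J :: "(int ^ 'd) set"
  defines "D \<equiv> CARD('d)"
  defines "\<epsilon> \<equiv> (1 / (512 * real D)) ^ D"
  assumes K: "\<And>\<omega> x. \<bar>coeff V \<beta> lam \<omega> x\<bar> + 1 + real (card (lateral e (0 :: int ^ 'd))) \<le> K"
    and \<beta>: "\<beta> > 0" and L: "L \<ge> 64 * real D"
    and C1: "C1 \<ge> ln K + 2 / \<beta>"
    and J: "cube L \<subseteq> J" "finite J"
  shows "measure coin_measure {\<omega>. override_on \<eta> \<omega> J \<in> uc_event V \<beta> e \<epsilon> C1 L u0 lam} \<ge> 1 - exp (- \<epsilon> * L)"
proof -
  let ?\<Omega> = "{\<omega>. \<forall>x. x \<notin> J \<longrightarrow> \<omega> x = \<eta> x}" and ?E = "uc_event V \<beta> e \<epsilon> C1 L u0 lam"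
  \<comment> \<open>The largest integer with \<open>64 * D * r \<le> L\<close>; the lower bound on
    \<open>L\<close> makes it positive.\<close>
  define r where "r = nat \<lfloor>L / (64 * real D)\<rfloor>"
  have D: "D \<ge> 1" unfolding D_def by (simp add: Suc_leI)
  have K1: "K \<ge> 1" using K[of undefined 0] abs_ge_zero[of "coeff V \<beta> lam undefined 0"] by linarith
  have q1: "L / (64 * real D) \<ge> 1" using L D by simp
  then have rr: "real r = of_int \<lfloor>L / (64 * real D)\<rfloor>" unfolding r_def by simp
  have r1: "r \<ge> 1" using q1 unfolding r_def by (simp add: le_nat_iff le_floor_iff)
  have "real r \<le> L / (64 * real D)" "L / (64 * real D) \<le> real r + 1" unfolding rr by linarith+
  then have rL: "64 * real D * real r \<le> L" "L \<le> 64 * real D * (real r + 1)"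
    using D by (auto simp: field_simps)
  have L1: "L \<ge> 1" using L D by linarith
  have "real (32 * D * r) \<le> L" using rL L1 by simp
  then have C1_bound: "2 * exp (- C1 * L) * K ^ (32 * D * r) \<le> \<beta>"
    using \<beta> K1 L1 C1 by (intro exp_power_bound)
  have sol: "solves e (\<lambda>x. 2 * real CARD('d) + V x - lam + \<beta> * of_bool (\<omega> x)) (solution V \<beta> e lam u0 \<omega>)" for \<omega>
    using solution_solves[of e V \<beta> lam \<omega> u0] by (simp add: coeff_def[abs_def])
  have bad: "real (card (?\<Omega> - ?E)) \<le> exp (- \<epsilon> * L) * real (card ?\<Omega>)"
    using few_bad_configs[where u = "solution V \<beta> e lam u0" and G = "\<lambda>x. 2 * real CARD('d) + V x - lam"
        and e = e and \<beta> = \<beta> and K = K and L = L and J = J and r = r and ?C1.0 = C1,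
        OF sol solution_initial _ \<beta> r1 _ _ _ J] K rL C1_bound
    unfolding uc_event_def \<epsilon>_def D_def coeff_def by simp
  have fin: "finite ?\<Omega>" using J(2) by (rule finite_configs)
  have "\<eta> \<in> ?\<Omega>" by simp
  then have pos: "real (card ?\<Omega>) > 0" using fin by (simp only: of_nat_0_less_iff card_gt_0_iff) blast
  have "card ?\<Omega> = card (?\<Omega> \<inter> ?E) + card (?\<Omega> - ?E)" by (rule card_Int_Diff[OF fin])
  then have "(1 - exp (- \<epsilon> * L)) * real (card ?\<Omega>) \<le> real (card (?\<Omega> \<inter> ?E))"
    using bad by (simp add: algebra_simps)
  also have "\<dots> = measure coin_measure {\<omega>. override_on \<eta> \<omega> J \<in> ?E} * real (card ?\<Omega>)"
    using measure_coin_override[OF J(2), of \<eta> ?E] by simp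
  finally show ?thesis using pos by (rule mult_right_le_imp_le)
qed

theorem theorem2p6:
  fixes e :: "'d::finite"
  assumes "CARD('d) \<ge> 2"
  shows "\<exists>\<epsilon>>0. \<forall>h \<beta>. h > 4 * real CARD('d) + 1 \<and> 0 < \<beta> \<and> \<beta> \<le> 1 \<longrightarrow>
    (\<exists>C1>1. \<forall>d0 \<alpha> N V \<iota> lam u0 L.
      d0 > 1 \<and> \<alpha> > 1 \<and> N \<ge> 1 \<and>
      hierarchical_potential d0 \<alpha> N h (V :: int ^ 'd \<Rightarrow> real) \<and>
      \<iota> = min (1/100) ((h - 4 * real CARD('d) - \<beta>) / 2) \<and>
      - \<iota> \<le> lam \<and> lam \<le> 4 * real CARD('d) + \<beta> + \<iota> \<and> L \<ge> C1 \<longrightarrow>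
      measure coin_measure (uc_event V \<beta> e \<epsilon> C1 L u0 lam) \<ge> 1 - exp (- \<epsilon> * L) \<and>
      (\<forall>\<eta>. measure coin_measure
              {\<omega>. override_on \<eta> \<omega> (cube L) \<in> uc_event V \<beta> e \<epsilon> C1 L u0 lam}
            \<ge> 1 - exp (- \<epsilon> * L)))"
proof (rule exI[of _ "(1 / (512 * real CARD('d))) ^ CARD('d)"], intro conjI allI impI)
  show "(1 / (512 * real CARD('d))) ^ CARD('d) > 0" by simp
next
  fix h \<beta> :: real
  let ?\<epsilon> = "(1 / (512 * real CARD('d))) ^ CARD('d)"
  assume h\<beta>: "h > 4 * real CARD('d) + 1 \<and> 0 < \<beta> \<and> \<beta> \<le> 1"
  \<comment> \<open>The bound \<open>6d + h + 3\<close> for the coefficient, plus one for the point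
    two units away, plus the number of lateral neighbours.\<close>
  define K where "K = 6 * real CARD('d) + h + 4 + real (card (lateral e (0 :: int ^ 'd)))"
  \<comment> \<open>The first summand ensures \<open>L \<ge> 64d\<close>, so that
    \<open>r \<ge> 1\<close>; the others are those required by
    \<open>exp_power_bound\<close>.\<close>
  define C1 where "C1 = 64 * real CARD('d) + ln K + 2 / \<beta>"
  have "K \<ge> 1" using h\<beta> by (simp add: K_def)
  then have lnK: "ln K \<ge> 0" by simp
  have \<beta>2: "2 / \<beta> > 0" using h\<beta> by simp
  have "C1 > 1" using lnK \<beta>2 assms unfolding C1_def by linarith
  then show "\<exists>C1>1. \<forall>d0 \<alpha> N V \<iota> lam u0 L.
      d0 > 1 \<and> \<alpha> > 1 \<and> N \<ge> 1 \<and>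
      hierarchical_potential d0 \<alpha> N h (V :: int ^ 'd \<Rightarrow> real) \<and>
      \<iota> = min (1/100) ((h - 4 * real CARD('d) - \<beta>) / 2) \<and>
      - \<iota> \<le> lam \<and> lam \<le> 4 * real CARD('d) + \<beta> + \<iota> \<and> L \<ge> C1 \<longrightarrow>
      measure coin_measure (uc_event V \<beta> e ?\<epsilon> C1 L u0 lam) \<ge> 1 - exp (- ?\<epsilon> * L) \<and>
      (\<forall>\<eta>. measure coin_measure
              {\<omega>. override_on \<eta> \<omega> (cube L) \<in> uc_event V \<beta> e ?\<epsilon> C1 L u0 lam}
            \<ge> 1 - exp (- ?\<epsilon> * L))"
  proof (intro exI[of _ C1] conjI[of "C1 > 1"] allI impI)
    fix d0 \<alpha> N and V :: "int ^ 'd \<Rightarrow> real" and \<iota> lam u0 L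
    assume "d0 > 1 \<and> \<alpha> > 1 \<and> N \<ge> 1 \<and>
      hierarchical_potential d0 \<alpha> N h V \<and>
      \<iota> = min (1/100) ((h - 4 * real CARD('d) - \<beta>) / 2) \<and>
      - \<iota> \<le> lam \<and> lam \<le> 4 * real CARD('d) + \<beta> + \<iota> \<and> L \<ge> C1"
    then have H: "hierarchical_potential d0 \<alpha> N h V"
      and \<iota>: "\<iota> = min (1/100) ((h - 4 * real CARD('d) - \<beta>) / 2)"
      and lam: "- \<iota> \<le> lam" "lam \<le> 4 * real CARD('d) + \<beta> + \<iota>" and L: "L \<ge> C1"
      by blast+
    have gK: "\<bar>coeff V \<beta> lam \<omega> x\<bar> + 1 + real (card (lateral e (0 :: int ^ 'd))) \<le> K" for \<omega> x
    proof -
      have "V x \<in> {0, h}" using H unfolding hierarchical_potential_def by blast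
      then have "0 \<le> V x" "V x \<le> h" using h\<beta> by auto
      moreover have "- 1 \<le> lam" "lam \<le> 4 * real CARD('d) + 2" using lam h\<beta> \<iota> by linarith+
      ultimately have "\<bar>coeff V \<beta> lam \<omega> x\<bar> \<le> 6 * real CARD('d) + h + 3"
        using h\<beta> by (intro abs_coeff_le) auto
      then show ?thesis by (simp add: K_def)
    qed
    have L64: "L \<ge> 64 * real CARD('d)" using L lnK \<beta>2 unfolding C1_def by linarith
    have C: "C1 \<ge> ln K + 2 / \<beta>" by (simp add: C1_def)
    have prob: "measure coin_measure {\<omega>. override_on \<eta> \<omega> J \<in> uc_event V \<beta> e ?\<epsilon> C1 L u0 lam}
        \<ge> 1 - exp (- ?\<epsilon> * L)" if "cube L \<subseteq> J" "finite J" for J \<eta>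
      using h\<beta> by (intro prob_override_uc_event[OF gK _ L64 C that]) auto
    have L0: "L \<ge> 0" by (rule order_trans[OF _ L64]) simp
    \<comment> \<open>The event depends only on the coins in the cube of radius
      \<open>3 * L + 1\<close>, so freezing the rest leaves it unchanged and the bound with this
      cube as \<open>J\<close> gives the full probability.\<close>
    have "override_on undefined \<omega> (cube (3 * L + 1)) \<in> uc_event V \<beta> e ?\<epsilon> C1 L u0 lam \<longleftrightarrow>
        \<omega> \<in> uc_event V \<beta> e ?\<epsilon> C1 L u0 lam" for \<omega>
      using L0 by (intro uc_event_local) auto
    moreover have "(cube L :: (int ^ 'd) set) \<subseteq> cube (3 * L + 1)"
      using L0 by (auto simp: cube_def)
    ultimately have "measure coin_measure (uc_event V \<beta> e ?\<epsilon> C1 L u0 lam) \<ge> 1 - exp (- ?\<epsilon> * L)"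
      using prob[of "cube (3 * L + 1)" undefined] by (simp add: finite_cube)
    \<comment> \<open>With \<open>J\<close> equal to the cube of radius \<open>L\<close>, only the
      coins inside it are random and those outside are arbitrary.\<close>
    moreover have "\<forall>\<eta>. measure coin_measure
        {\<omega>. override_on \<eta> \<omega> (cube L) \<in> uc_event V \<beta> e ?\<epsilon> C1 L u0 lam} \<ge> 1 - exp (- ?\<epsilon> * L)"
      using prob[of "cube L"] by (simp add: finite_cube)
    ultimately show "measure coin_measure (uc_event V \<beta> e ?\<epsilon> C1 L u0 lam) \<ge> 1 - exp (- ?\<epsilon> * L) \<and>
      (\<forall>\<eta>. measure coin_measure
        {\<omega>. override_on \<eta> \<omega> (cube L) \<in> uc_event V \<beta> e ?\<epsilon> C1 L u0 lam} \<ge> 1 - exp (- ?\<epsilon> * L))" ..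
  qed
qed

end
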